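(* There exist a dendrite $D$ and a continuous map $f\colon D\to D$ such that: (1) $f$ has an uncountable $\omega$-scrambled set; (2) $f$ does not have an infinite LY-scrambled set.
   Context: A continuum is a nonempty connected compact metric space. A dendrite is a locally connected continuum containing no subset homeomorphic to the circle. Let $(X,\rho)$ be a compact metric space and $f\colon X\to X$ continuous. For $x\in X$ the orbit is $O_f(x)=\{f^k(x):k\ge 0\}$ and the $\omega$-limit set is $\omega_f(x)=\bigcap_{n}\overline{O_f(f^n(x))}$. A pair of distinct points $x,y\in X$ is proximal if $\liminf_{n\to\infty}\rho(f^n(x),f^n(y))=0$, asymptotic if $\lim_{n\to\infty}\rho(f^n(x),f^n(y))=0$, and scrambled (or Li-Yorke) if it is proximal but not asymptotic. A set $S\subseteq X$ is LY-scrambled for $f$ if it contains at least two distinct points and every pair of distinct points of $S$ is scrambled. A set $S\subseteq X$ is $\omega$-scrambled for $f$ if it contains at least two points and for any $x,y\in S$ with $x\ne y$: (i) $\omega_f(x)\setminus\omega_f(y)$ is uncountable; (ii) $\omega_f(x)\cap\omega_f(y)$ is nonempty; (iii) $\omega_f(x)$ is not contained in the set of periodic points of $f$. *)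

theory Defs
  imports "HOL-Analysis.Analysis"
begin

text \<open>
  Metric spaces are given by a carrier \<open>X\<close> and a distance \<open>\<rho>\<close>. A self-map of \<open>X\<close> is a function
  on the whole ambient type; only its values on \<open>X\<close> matter.
  Compact metric spaces have at most continuum many points, so those with carrier in
  \<open>nat \<Rightarrow> real\<close> and an arbitrary distance \<open>\<rho>\<close> cover all of them up to isometry.
\<close>

definition continuum :: "'a set \<Rightarrow> ('a \<Rightarrow> 'a \<Rightarrow> real) \<Rightarrow> bool" where
  "continuum X \<rho> \<longleftrightarrow>
     Metric_space X \<rho> \<and> X \<noteq> {} \<and>
     connected_space (Metric_space.mtopology X \<rho>) \<and>
     compact_space (Metric_space.mtopology X \<rho>)"

definition dendrite :: "'a set \<Rightarrow> ('a \<Rightarrow> 'a \<Rightarrow> real) \<Rightarrow> bool" where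
  "dendrite X \<rho> \<longleftrightarrow>
     continuum X \<rho> \<and>
     locally_connected_space (Metric_space.mtopology X \<rho>) \<and>
     \<not> (\<exists>C \<subseteq> X. subtopology (Metric_space.mtopology X \<rho>) C
                  homeomorphic_space top_of_set (sphere (0::complex) 1))"

definition orbit_of :: "('a \<Rightarrow> 'a) \<Rightarrow> 'a \<Rightarrow> 'a set" where
  "orbit_of f x = {(f ^^ k) x |k. True}"

definition omega_limit :: "'a set \<Rightarrow> ('a \<Rightarrow> 'a \<Rightarrow> real) \<Rightarrow> ('a \<Rightarrow> 'a) \<Rightarrow> 'a \<Rightarrow> 'a set" where
  "omega_limit X \<rho> f x =
     (\<Inter>n. Metric_space.mtopology X \<rho> closure_of orbit_of f ((f ^^ n) x))"

definition periodic_points :: "'a set \<Rightarrow> ('a \<Rightarrow> 'a) \<Rightarrow> 'a set" where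
  "periodic_points X f = {x \<in> X. \<exists>p>0. (f ^^ p) x = x}"

text \<open>The limit inferior is taken in \<^typ>\<open>ereal\<close>, because \<^typ>\<open>real\<close> is not a complete lattice.\<close>

definition proximal :: "('a \<Rightarrow> 'a \<Rightarrow> real) \<Rightarrow> ('a \<Rightarrow> 'a) \<Rightarrow> 'a \<Rightarrow> 'a \<Rightarrow> bool" where
  "proximal \<rho> f x y \<longleftrightarrow>
     x \<noteq> y \<and> liminf (\<lambda>n. ereal (\<rho> ((f ^^ n) x) ((f ^^ n) y))) = 0"

definition asymptotic :: "('a \<Rightarrow> 'a \<Rightarrow> real) \<Rightarrow> ('a \<Rightarrow> 'a) \<Rightarrow> 'a \<Rightarrow> 'a \<Rightarrow> bool" where
  "asymptotic \<rho> f x y \<longleftrightarrow>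
     x \<noteq> y \<and> (\<lambda>n. \<rho> ((f ^^ n) x) ((f ^^ n) y)) \<longlonglongrightarrow> 0"

definition scrambled_pair :: "('a \<Rightarrow> 'a \<Rightarrow> real) \<Rightarrow> ('a \<Rightarrow> 'a) \<Rightarrow> 'a \<Rightarrow> 'a \<Rightarrow> bool" where
  "scrambled_pair \<rho> f x y \<longleftrightarrow> proximal \<rho> f x y \<and> \<not> asymptotic \<rho> f x y"

definition LY_scrambled ::
    "'a set \<Rightarrow> ('a \<Rightarrow> 'a \<Rightarrow> real) \<Rightarrow> ('a \<Rightarrow> 'a) \<Rightarrow> 'a set \<Rightarrow> bool" where
  "LY_scrambled X \<rho> f S \<longleftrightarrow>
     S \<subseteq> X \<and> (\<exists>x\<in>S. \<exists>y\<in>S. x \<noteq> y) \<and>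
     (\<forall>x\<in>S. \<forall>y\<in>S. x \<noteq> y \<longrightarrow> scrambled_pair \<rho> f x y)"

definition omega_scrambled ::
    "'a set \<Rightarrow> ('a \<Rightarrow> 'a \<Rightarrow> real) \<Rightarrow> ('a \<Rightarrow> 'a) \<Rightarrow> 'a set \<Rightarrow> bool" where
  "omega_scrambled X \<rho> f S \<longleftrightarrow>
     S \<subseteq> X \<and> (\<exists>x\<in>S. \<exists>y\<in>S. x \<noteq> y) \<and>
     (\<forall>x\<in>S. \<forall>y\<in>S. x \<noteq> y \<longrightarrow>
        uncountable (omega_limit X \<rho> f x - omega_limit X \<rho> f y) \<and>
        omega_limit X \<rho> f x \<inter> omega_limit X \<rho> f y \<noteq> {} \<and>
        \<not> omega_limit X \<rho> f x \<subseteq> periodic_points X f)"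

end

theory Submission
  imports Defs
begin

text \<open>
The example is a shift-like map on a tree of finite words. Let \<open>Y\<close> be a compact set of sequences
with entries \<open>1\<close> and \<open>-1\<close>. The finite prefixes of members of \<open>Y\<close> are the vertices of a rooted
binary tree, and completing this tree by its ends gives a dendrite whose set of ends is \<open>Y\<close>.
Concretely, a point of the dendrite is a pointwise product \<open>h\<cdot>y\<close>, where \<open>y\<close> is in \<open>Y\<close> and the
profile \<open>h\<close> has the form \<open>1, \<dots>, 1, r, 0, 0, \<dots>\<close> with \<open>r\<close> in the unit interval, or is constantly
\<open>1\<close>: it is the branch \<open>y\<close> cut off at the height that \<open>h\<close> encodes. As a subset of the product space
\<open>\<real>\<^sup>\<nat>\<close>, this is a dendrite because two nearby points are joined by a path through their
meet that stays near both (\<open>tree_points_joined\<close>), while a single point separates any two points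
(\<open>tree_cut_point\<close>), which no circle allows.

The map moves an end by a continuous self-map of \<open>Y\<close> and lowers the height by two. Hence every point
that is not an end reaches the root after finitely many steps, and the Li--Yorke
behaviour is, up to one point, that of the system on \<open>Y\<close>.

A point of \<open>Y\<close> interleaves a 2-adic integer \<open>z\<close>, on which the odometer \<open>z \<mapsto> z + 1\<close> acts, with a
binary sequence \<open>c\<close> of marks, on which the shift acts. The odometer is an isometry, so a proximal
pair of ends has the same \<open>z\<close> (\<open>proximal_same_odometer_state\<close>). This confines a scrambled set of ends to a
single fibre over the odometer. The fibres are kept small: \<open>Y\<close> contains all \<open>(z, c)\<close> where \<open>c\<close> has at
most one mark, and any two of these in one fibre become equal once their marks have passed; the only other
members are the orbits of points \<open>(s, c\<^sub>s)\<close>, where \<open>s\<close> ranges over an uncountable closed set meeting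
every odometer orbit at most once, so that they contribute at most one point to a fibre. Thus a
Li--Yorke scrambled set has at most three points (\<open>LY_scrambled_finite\<close>).

The marks of \<open>c\<^sub>s\<close> have gaps that grow at a rate independent of \<open>s\<close>, so that orbits accumulate only
at sequences with at most one mark; this makes \<open>Y\<close> compact (\<open>compact_ends\<close>). The exact time of the
\<open>i\<close>-th mark can still be chosen modulo \<open>2\<^sup>i\<close>, which prescribes the first \<open>i\<close> digits
of the odometer when the mark passes coordinate zero. The times are chosen such that the states
\<open>z\<close> seen at marks accumulate exactly at those with \<open>z\<^sub>2\<^sub>j = s\<^sub>j\<close> for all \<open>j\<close>
(\<open>single_mark_in_omega_limit_iff\<close>). For different \<open>s\<close> these sets are disjoint, and each is uncountable,
whereas all the limit sets share the unmarked points (\<open>common_omega_limit_point\<close>).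
\<close>

section \<open>The product topology on real sequences\<close>

text \<open>
Boxes restricting finitely many coordinates replace metric balls throughout: dynamics and
connectedness are both visible coordinate by coordinate.
\<close>

definition coord_box :: "nat \<Rightarrow> real \<Rightarrow> (nat \<Rightarrow> real) \<Rightarrow> (nat \<Rightarrow> real) set" where
  "coord_box n e p = {q. \<forall>i<n. \<bar>q i - p i\<bar> < e}"

lemma open_coord_box: "open (coord_box n e p)"
proof -
  have "coord_box n e p = (\<Inter>i<n. {q. \<bar>q i - p i\<bar> < e})" by (auto simp: coord_box_def)
  moreover have "open {q :: nat \<Rightarrow> real. \<bar>q i - p i\<bar> < e}" for i
    by (intro open_Collect_less continuous_intros continuous_on_product_coordinates)
  ultimately show ?thesis by auto
qed

lemma centre_in_coord_box: "0 < e \<Longrightarrow> p \<in> coord_box n e p" by (simp add: coord_box_def)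

lemma open_contains_box:
  assumes "open V" "p \<in> V"
  obtains n e where "0 < e" "e \<le> 1" "coord_box n e p \<subseteq> V"
proof -
  have "openin (product_topology (\<lambda>i. euclidean) UNIV) V"
    using assms by (simp add: open_fun_def)
  from product_topology_open_contains_basis[OF this assms(2)]
  obtain X where X: "p \<in> Pi\<^sub>E UNIV X" "\<And>i. open (X i)" "finite {i. X i \<noteq> UNIV}"
    "Pi\<^sub>E UNIV X \<subseteq> V" by auto
  have "\<exists>e>0. e \<le> 1 \<and> (\<forall>x. \<bar>x - p i\<bar> < e \<longrightarrow> x \<in> X i)" for i
  proof -
    have "p i \<in> X i" using X(1) by auto
    then obtain e where "e > 0" "ball (p i) e \<subseteq> X i" using X(2) open_contains_ball by blast
    then show ?thesis
      by (intro exI[of _ "min e 1"]) (auto simp: subset_iff dist_real_def abs_minus_commute)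
  qed
  then obtain e where e: "\<And>i. 0 < e i" "\<And>i. e i \<le> 1" "\<And>i x. \<bar>x - p i\<bar> < e i \<Longrightarrow> x \<in> X i"
    by metis
  obtain n where n: "\<And>i. X i \<noteq> UNIV \<Longrightarrow> i < n"
    using X(3) finite_nat_set_iff_bounded by auto
  define d where "d = Min (insert 1 (e ` {..<n}))"
  have "0 < d" "d \<le> 1" using e(1) by (auto simp: d_def)
  moreover have "coord_box n d p \<subseteq> V"
  proof
    fix q assume q: "q \<in> coord_box n d p"
    have "q i \<in> X i" for i
    proof (cases "i < n")
      case True
      then have "d \<le> e i" by (auto simp: d_def)
      with q True show ?thesis by (intro e(3)) (force simp: coord_box_def)
    next
      case False
      then show ?thesis using n[of i] by auto
    qed
    then show "q \<in> V" using X(4) by auto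
  qed
  ultimately show ?thesis using that by blast
qed

lemma mem_closure_iff_box:
  fixes A :: "(nat \<Rightarrow> real) set"
  shows "p \<in> closure A \<longleftrightarrow> (\<forall>n. \<forall>e>0. \<exists>q\<in>A. q \<in> coord_box n e p)"
proof
  assume p: "p \<in> closure A"
  show "\<forall>n. \<forall>e>0. \<exists>q\<in>A. q \<in> coord_box n e p"
  proof (intro allI impI)
    fix n and e :: real assume "e > 0"
    then have "coord_box n e p \<inter> closure A \<noteq> {}" using p centre_in_coord_box by blast
    then show "\<exists>q\<in>A. q \<in> coord_box n e p"
      using open_Int_closure_eq_empty[OF open_coord_box] by blast
  qed
next
  assume r: "\<forall>n. \<forall>e>0. \<exists>q\<in>A. q \<in> coord_box n e p"
  show "p \<in> closure A"
  proof (rule ccontr)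
    assume "p \<notin> closure A"
    then have "p \<in> - closure A" "open (- closure A)" by auto
    then obtain n e where "0 < e" "coord_box n e p \<subseteq> - closure A" using open_contains_box by blast
    then show False using r closure_subset by blast
  qed
qed

text \<open>
The metric on functions enumerates its index type by the abstract \<open>to_nat\<close>, hence this weight.
\<close>

lemma coordinate_le_dist:
  fixes x y :: "nat \<Rightarrow> real"
  shows "(1/2) ^ to_nat i * min \<bar>x i - y i\<bar> 1 \<le> dist x y"
proof -
  have *: "summable (\<lambda>n. (1/2)^n * min (dist (x (from_nat n)) (y (from_nat n))) 1)"
    by (rule summable_comparison_test'[of "\<lambda>n. (1/2)^n"], auto simp add: summable_geometric_iff)
  show ?thesis
    using sum_le_suminf[OF *, of "{to_nat i}"] by (simp add: dist_fun_def dist_real_def)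
qed

lemma compact_cube: "compact {p :: nat \<Rightarrow> real. \<forall>i. \<bar>p i\<bar> \<le> 1}"
proof -
  have "compactin (product_topology (\<lambda>i::nat. euclidean :: real topology) UNIV)
          (Pi\<^sub>E UNIV (\<lambda>i. {-1..1}))"
    by (subst compactin_PiE) auto
  moreover have "Pi\<^sub>E UNIV (\<lambda>i::nat. {-1..1::real}) = {p. \<forall>i. \<bar>p i\<bar> \<le> 1}"
    by (auto simp: abs_le_iff PiE_iff minus_le_iff)
  ultimately show ?thesis
    by (simp add: euclidean_product_topology)
qed

lemma closed_in_cube_imp_compact:
  fixes A :: "(nat \<Rightarrow> real) set"
  assumes "closed A" "\<And>p i. p \<in> A \<Longrightarrow> \<bar>p i\<bar> \<le> 1"
  shows "compact A"
proof -
  have "A = {p. \<forall>i. \<bar>p i\<bar> \<le> 1} \<inter> A" using assms(2) by auto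
  then show ?thesis using compact_Int_closed[OF compact_cube assms(1)] by simp
qed

section \<open>The dendrite with a given set of ends\<close>

text \<open>
The profiles form an arc: they are \<open>1, \<dots>, 1, r, 0, 0, \<dots>\<close> with \<open>0 \<le> r \<le> 1\<close>, ordered pointwise,
together with the constant sequence \<open>1\<close>.
\<close>

definition profiles :: "(nat \<Rightarrow> real) set" where
  "profiles = {h. \<forall>n. 0 \<le> h n \<and> h n \<le> 1 \<and> (h n = 1 \<or> h (Suc n) = 0)}"

definition scale :: "(nat \<Rightarrow> real) \<Rightarrow> (nat \<Rightarrow> real) \<Rightarrow> nat \<Rightarrow> real" where
  "scale h y = (\<lambda>i. h i * y i)"

definition sign_seqs :: "(nat \<Rightarrow> real) set" where
  "sign_seqs = {y. \<forall>i. y i = 1 \<or> y i = -1}"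

definition tree :: "(nat \<Rightarrow> real) set \<Rightarrow> (nat \<Rightarrow> real) set" where
  "tree Y = (\<lambda>(h, y). scale h y) ` (profiles \<times> Y)"

lemma profilesD:
  assumes "h \<in> profiles"
  shows "0 \<le> h n" "h n \<le> 1" "h n \<noteq> 1 \<Longrightarrow> h (Suc n) = 0"
  using assms by (auto simp: profiles_def)

lemma profile_full_below:
  assumes "h \<in> profiles" "i < j" "h j \<noteq> 0"
  shows "h i = 1"
  using assms(2,3)
proof (induction j)
  case (Suc j)
  have "h j = 1" using profilesD(3)[OF assms(1)] Suc.prems by blast
  then show ?case using Suc by (cases "i = j") auto
qed simp

lemma profiles_min:
  assumes "h \<in> profiles" "k \<in> profiles"
  shows "(\<lambda>i. min (h i) (k i)) \<in> profiles"
proof -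
  have "(h n = 1 \<and> k n = 1) \<or> h (Suc n) = 0 \<or> k (Suc n) = 0" for n
    using assms by (auto simp: profiles_def)
  moreover have "0 \<le> h n" "0 \<le> k n" "h n \<le> 1" "k n \<le> 1" for n
    using assms by (auto simp: profiles_def)
  ultimately have "0 \<le> min (h n) (k n) \<and> min (h n) (k n) \<le> 1 \<and>
      (min (h n) (k n) = 1 \<or> min (h (Suc n)) (k (Suc n)) = 0)" for n
    by (smt (verit))
  then show ?thesis by (simp add: profiles_def)
qed

lemma profiles_max:
  assumes "h \<in> profiles" "k \<in> profiles"
  shows "(\<lambda>i. max (h i) (k i)) \<in> profiles"
proof -
  have "h n = 1 \<or> k n = 1 \<or> (h (Suc n) = 0 \<and> k (Suc n) = 0)" for n
    using assms by (auto simp: profiles_def)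
  moreover have "0 \<le> h n" "0 \<le> k n" "h n \<le> 1" "k n \<le> 1" for n
    using assms by (auto simp: profiles_def)
  ultimately have "0 \<le> max (h n) (k n) \<and> max (h n) (k n) \<le> 1 \<and>
      (max (h n) (k n) = 1 \<or> max (h (Suc n)) (k (Suc n)) = 0)" for n
    by (smt (verit))
  then show ?thesis by (simp add: profiles_def)
qed

lemma compact_profiles: "compact profiles"
proof (rule closed_in_cube_imp_compact)
  show "closed profiles" unfolding profiles_def
    by (intro closed_Collect_all closed_Collect_conj closed_Collect_disj closed_Collect_le
        closed_Collect_eq continuous_intros continuous_on_product_coordinates)
qed (simp add: abs_of_nonneg profilesD(1,2))

lemma continuous_on_scale:
  assumes "continuous_on S f" "continuous_on S g"
  shows "continuous_on S (\<lambda>x. scale (f x) (g x))"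
proof -
  have "continuous_on S (\<lambda>x. f x i * g x i)" for i
    by (intro continuous_on_mult continuous_on_product_then_coordinatewise[OF assms(1)]
        continuous_on_product_then_coordinatewise[OF assms(2)])
  then show ?thesis unfolding scale_def by (rule continuous_on_coordinatewise_then_product)
qed

lemma compact_tree: "compact Y \<Longrightarrow> compact (tree Y)"
  unfolding tree_def case_prod_beta
  by (intro compact_continuous_image compact_Times compact_profiles
      continuous_on_scale continuous_on_fst continuous_on_snd continuous_on_id)

text \<open>
A parametrization of the arc of profiles by the unit interval; coordinate \<open>i\<close> rises from \<open>0\<close> to \<open>1\<close>
while \<open>u\<close> runs from \<open>1 - 1/(i + 1)\<close> to \<open>1 - 1/(i + 2)\<close>.
\<close>

definition ramp :: "real \<Rightarrow> nat \<Rightarrow> real" where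
  "ramp u i = max 0 (min 1 ((real i + 2) * (1 - (real i + 1) * (1 - u))))"

lemma ramp_profile: "u \<le> 1 \<Longrightarrow> ramp u \<in> profiles"
proof -
  assume u: "u \<le> 1"
  have "ramp u n = 1 \<or> ramp u (Suc n) = 0" for n
  proof (cases "(real n + 2) * (1 - (real n + 1) * (1 - u)) \<ge> 1")
    case True
    then show ?thesis by (simp add: ramp_def)
  next
    case False
    then have "(real n + 1) * (1 - (real n + 2) * (1 - u)) < 0" by (simp add: algebra_simps)
    then have "1 - (real n + 2) * (1 - u) < 0" by (simp add: mult_less_0_iff)
    then have "(real n + 3) * (1 - (real n + 2) * (1 - u)) \<le> 0"
      by (intro mult_nonneg_nonpos) auto
    then show ?thesis by (simp add: ramp_def algebra_simps)
  qed
  then show ?thesis by (auto simp: profiles_def ramp_def)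
qed

lemma ramp_0: "ramp 0 i = 0"
proof -
  have "(real i + 2) * (1 - (real i + 1) * (1 - 0)) \<le> 0"
    by (intro mult_nonneg_nonpos) auto
  then show ?thesis unfolding ramp_def by (smt (verit))
qed

lemma ramp_1: "ramp 1 i = 1"
  by (simp add: ramp_def)

lemma continuous_ramp: "continuous_on A (\<lambda>u. ramp u i)"
  unfolding ramp_def by (intro continuous_intros)

text \<open>
Clamping the path of ramps between two profiles \<open>k \<le> h\<close> gives a path from \<open>k\<close> to \<open>h\<close> along which
every coordinate stays in between.
\<close>

lemma branch_segment:
  assumes "h \<in> profiles" "k \<in> profiles" "\<And>i. k i \<le> h i" "y \<in> Y"
  obtains C where "connected C" "scale k y \<in> C" "scale h y \<in> C" "C \<subseteq> tree Y"
    "\<And>q i. q \<in> C \<Longrightarrow> \<exists>t. k i \<le> t \<and> t \<le> h i \<and> q i = t * y i"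
proof -
  define g where "g = (\<lambda>u i. max (k i) (min (h i) (ramp u i)))"
  define C where "C = (\<lambda>u. scale (g u) y) ` {0..1}"
  have "connected C" unfolding C_def g_def
    by (intro connected_continuous_image continuous_on_scale
        continuous_on_coordinatewise_then_product continuous_on_max continuous_on_min
        continuous_on_const continuous_ramp) simp
  moreover have "g 0 = k" using profilesD[OF assms(2)] profilesD[OF assms(1)]
    by (auto simp: g_def ramp_0 fun_eq_iff)
  then have "scale k y \<in> C" by (force simp: C_def)
  moreover have "g 1 = h" using profilesD[OF assms(1)] assms(3)
    by (auto simp: g_def ramp_1 fun_eq_iff)
  then have "scale h y \<in> C" by (force simp: C_def)
  moreover have "g u \<in> profiles" if "u \<le> 1" for u
    unfolding g_def using assms ramp_profile[OF that] by (intro profiles_max profiles_min)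
  then have "C \<subseteq> tree Y" using assms(4) by (auto simp: C_def tree_def)
  moreover have "\<exists>t. k i \<le> t \<and> t \<le> h i \<and> q i = t * y i" if "q \<in> C" for q i
  proof -
    from that obtain u where "q = scale (g u) y" by (auto simp: C_def)
    moreover have "k i \<le> g u i" "g u i \<le> h i" using assms(3)[of i] by (auto simp: g_def)
    ultimately show ?thesis by (auto simp: scale_def)
  qed
  ultimately show ?thesis using that by blast
qed

lemma initial_profile: "(\<lambda>i. if P i then 1 else 0) \<in> profiles"
  if "\<And>i. P (Suc i) \<Longrightarrow> P i"
  using that by (auto simp: profiles_def)

text \<open>
The path goes from \<open>p = h\<cdot>y\<close> down to the meet \<open>m\<close> of the two points and then up to \<open>q = k\<cdot>w\<close>. In each
coordinate below \<open>n\<close> the meet lies between \<open>p\<close> and \<open>q\<close>: either \<open>y\<close> and \<open>w\<close> agree so far, and the meet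
takes the smaller height, or they have parted and the meet is zero. In the latter case \<open>p\<close> and \<open>q\<close>
cannot have the same nonzero sign in that coordinate, because both would be full at the earlier
coordinate where \<open>y\<close> and \<open>w\<close> differ, and so would have distance \<open>2\<close> there.
\<close>

lemma tree_points_joined:
  assumes Y: "Y \<subseteq> sign_seqs" and p: "p \<in> tree Y" and q: "q \<in> tree Y"
    and e: "e \<le> 1" and pq: "q \<in> coord_box n e p"
  obtains C where "connected C" "p \<in> C" "q \<in> C" "C \<subseteq> tree Y \<inter> coord_box n e p"
proof -
  from p obtain h y where h: "h \<in> profiles" "y \<in> Y" "p = scale h y" by (auto simp: tree_def)
  from q obtain k w where k: "k \<in> profiles" "w \<in> Y" "q = scale k w" by (auto simp: tree_def)
  \<comment> \<open>the profile of the meet of \<open>p\<close> and \<open>q\<close>\<close>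
  define m where "m = (\<lambda>i. min (min (h i) (k i)) (if \<forall>j\<le>i. y j = w j then 1 else 0))"
  have m: "m \<in> profiles" unfolding m_def
    by (intro profiles_min h k initial_profile) auto
  have mle: "m i \<le> h i" "m i \<le> k i" for i by (auto simp: m_def)
  have signs: "y i = 1 \<or> y i = -1" "w i = 1 \<or> w i = -1" for i
    using Y h k by (auto simp: sign_seqs_def)
  have pos: "0 \<le> h i" "0 \<le> k i" "h i \<le> 1" "k i \<le> 1" for i
    using h k profilesD by auto
  have agree: "m i = min (h i) (k i) \<and> y i = w i \<or>
      m i = 0 \<and> (i < n \<longrightarrow> p i * q i \<le> 0)" for i
  proof (cases "\<forall>j\<le>i. y j = w j")
    case True
    then show ?thesis using pos[of i] by (auto simp: m_def min_def)
  next
    case False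
    then obtain j where j: "y j \<noteq> w j" "j \<le> i" by auto
    have "p i * q i \<le> 0" if "i < n"
    proof (cases "i = j")
      case True
      then have "p i * q i = - (h i * k i)"
        using j(1) signs[of i] by (auto simp: h(3) k(3) scale_def)
      then show ?thesis using pos[of i] by simp
    next
      case False
      with j(2) have "j < i" by simp
      show ?thesis
      proof (cases "h i = 0 \<or> k i = 0")
        case True
        then show ?thesis by (auto simp: h(3) k(3) scale_def)
      next
        case False
        then have "h j = 1" "k j = 1"
          using \<open>j < i\<close> h(1) k(1) profile_full_below by blast+
        then have "\<bar>q j - p j\<bar> = 2"
          using j(1) signs[of j] by (auto simp: h(3) k(3) scale_def)
        moreover have "\<bar>q j - p j\<bar> < e"
          using pq \<open>j < i\<close> that by (simp add: coord_box_def)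
        ultimately show ?thesis using e by linarith
      qed
    qed
    moreover have "m i = 0" using False pos[of i] by (auto simp: m_def)
    ultimately show ?thesis by blast
  qed
  have eq: "scale m y = scale m w"
    unfolding scale_def using agree by (metis mult_zero_left)
  have near: "\<bar>q i - p i\<bar> < e" if "i < n" for i
    using pq that by (simp add: coord_box_def)
  have between: "\<bar>t * y i - p i\<bar> < e" if i: "i < n" and t: "m i \<le> t" "t \<le> h i" for i t
    using agree[of i] near[OF i] signs[of i] pos[of i] t i
    by (auto simp: h(3) k(3) scale_def min_def mult_le_0_iff abs_if split: if_splits)
  have between': "\<bar>t * w i - p i\<bar> < e" if i: "i < n" and t: "m i \<le> t" "t \<le> k i" for i t
    using agree[of i] near[OF i] signs[of i] pos[of i] t i
    by (auto simp: h(3) k(3) scale_def min_def mult_le_0_iff abs_if split: if_splits)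
  obtain C where C: "connected C" "scale m y \<in> C" "p \<in> C" "C \<subseteq> tree Y"
    "\<And>q i. q \<in> C \<Longrightarrow> \<exists>t. m i \<le> t \<and> t \<le> h i \<and> q i = t * y i"
    using branch_segment[OF h(1) m mle(1) h(2)] h(3) by metis
  obtain C' where C': "connected C'" "scale m w \<in> C'" "q \<in> C'" "C' \<subseteq> tree Y"
    "\<And>q i. q \<in> C' \<Longrightarrow> \<exists>t. m i \<le> t \<and> t \<le> k i \<and> q i = t * w i"
    using branch_segment[OF k(1) m mle(2) k(2)] k(3) by metis
  have "connected (C \<union> C')" using C C' eq by (intro connected_Un) auto
  moreover have "C \<union> C' \<subseteq> coord_box n e p"
    unfolding coord_box_def using C(5) C'(5) between between' by fastforce
  ultimately show ?thesis using that[of "C \<union> C'"] C C' by auto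
qed

lemma connected_tree:
  assumes "Y \<subseteq> sign_seqs" shows "connected (tree Y)"
proof (cases "tree Y = {}")
  case False
  then obtain p where p: "p \<in> tree Y" by blast
  have "connected_component (tree Y) p q" if "q \<in> tree Y" for q
  proof -
    have "q \<in> coord_box 0 1 p" by (simp add: coord_box_def)
    from tree_points_joined[OF assms p that order.refl this] obtain C
      where "connected C" "p \<in> C" "q \<in> C" "C \<subseteq> tree Y \<inter> coord_box 0 1 p" .
    then show ?thesis unfolding connected_component_def by blast
  qed
  then show ?thesis
    unfolding connected_iff_connected_component
    by (meson connected_component_sym connected_component_trans)
qed simp

lemma locally_connected_tree:
  assumes "Y \<subseteq> sign_seqs"
  shows "locally_connected_space (top_of_set (tree Y))"
  unfolding locally_connected_space_im_kleinen
proof (intro allI impI, elim conjE)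
  fix V p assume V: "openin (top_of_set (tree Y)) V" and p: "p \<in> V"
  then obtain U where U: "open U" "V = tree Y \<inter> U" by (auto simp: openin_open)
  with p obtain n e where ne: "0 < e" "e \<le> 1" "coord_box n e p \<subseteq> U" using open_contains_box by blast
  have "\<exists>C. connectedin (top_of_set (tree Y)) C \<and> C \<subseteq> V \<and> p \<in> C \<and> q \<in> C"
    if "q \<in> tree Y \<inter> coord_box n e p" for q
  proof -
    from that p U have "p \<in> tree Y" "q \<in> tree Y" "q \<in> coord_box n e p" by auto
    from tree_points_joined[OF assms this(1,2) ne(2) this(3)] obtain C
      where C: "connected C" "p \<in> C" "q \<in> C" "C \<subseteq> tree Y \<inter> coord_box n e p" .
    moreover from C(4) have "C \<subseteq> tree Y" "C \<subseteq> V" using U(2) ne(3) by auto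
    ultimately show ?thesis unfolding connectedin_subtopology by auto
  qed
  moreover have "openin (top_of_set (tree Y)) (tree Y \<inter> coord_box n e p)"
    using open_coord_box by (auto simp: openin_open)
  ultimately show "\<exists>W. openin (top_of_set (tree Y)) W \<and> p \<in> W \<and> W \<subseteq> V \<and>
          (\<forall>q\<in>W. \<exists>C. connectedin (top_of_set (tree Y)) C \<and> C \<subseteq> V \<and> p \<in> C \<and> q \<in> C)"
    using p U ne centre_in_coord_box by (intro exI[of _ "tree Y \<inter> coord_box n e p"]) auto
qed


lemma tree_coordinates:
  assumes "Y \<subseteq> sign_seqs" "q \<in> tree Y"
  shows "\<bar>q i\<bar> \<le> 1" "\<lbrakk>i < j; q j \<noteq> 0\<rbrakk> \<Longrightarrow> \<bar>q i\<bar> = 1"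
proof -
  from assms(2) obtain h y where h: "h \<in> profiles" "y \<in> Y" "q = scale h y" by (auto simp: tree_def)
  have "y i = 1 \<or> y i = -1" for i using h(2) assms(1) by (auto simp: sign_seqs_def)
  then have abs: "\<bar>q i\<bar> = h i" for i
    using profilesD(1)[OF h(1), of i] by (metis abs_minus_cancel abs_mult abs_of_nonneg
      abs_one h(3) mult.right_neutral scale_def)
  show "\<bar>q i\<bar> \<le> 1" using profilesD(2)[OF h(1)] abs by simp
  show "\<lbrakk>i < j; q j \<noteq> 0\<rbrakk> \<Longrightarrow> \<bar>q i\<bar> = 1"
    using profile_full_below[OF h(1), of i j] abs[of i] abs[of j] by auto
qed

text \<open>
Let \<open>n\<close> be the first coordinate in which the two points differ, and let \<open>v\<close> be a nonzero value
between their \<open>n\<close>-th coordinates. An interior point of an edge is determined by the edge and its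
height, so exactly one point of the tree has the common first \<open>n\<close> coordinates followed by \<open>v\<close>.
It separates the points above it, in the set \<open>U\<close>, from all others, in \<open>V\<close>.
\<close>

lemma tree_cut_point:
  assumes Y: "Y \<subseteq> sign_seqs" and a: "a \<in> tree Y" and b: "b \<in> tree Y" and "a \<noteq> b"
  obtains c U V where "open U" "open V" "U \<inter> V = {}" "tree Y - {c} \<subseteq> U \<union> V"
    "a \<in> U - {c}" "b \<in> V - {c}"
proof -
  define n where "n = (LEAST i. a i \<noteq> b i)"
  obtain i where "a i \<noteq> b i" using \<open>a \<noteq> b\<close> by (auto simp: fun_eq_iff)
  then have n: "a n \<noteq> b n" unfolding n_def by (rule LeastI)
  have below: "a i = b i" if "i < n" for i
    using not_less_Least[of i "\<lambda>i. a i \<noteq> b i"] that unfolding n_def by blast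
  \<comment> \<open>the claim for a point \<open>x\<close> that is further from the root than \<open>z\<close> in coordinate \<open>n\<close>; the factor \<open>s\<close> makes
    this coordinate of \<open>x\<close> positive\<close>
  have sep: "\<exists>c U V. open U \<and> open V \<and> U \<inter> V = {} \<and> tree Y - {c} \<subseteq> U \<union> V \<and> x \<in> U - {c} \<and> z \<in> V - {c}"
    if x: "x \<in> tree Y" and s: "s = 1 \<or> s = -1"
      and xz: "s * x n > 0" "s * x n > s * z n" for x z :: "nat \<Rightarrow> real" and s :: real
  proof -
    define v where "v = (s * x n + max 0 (s * z n)) / 2"
    have v: "0 < v" "s * z n < v" "v < s * x n" using xz by (auto simp: v_def)
    have "s * x n \<le> 1" using tree_coordinates(1)[OF Y x, of n] s by (auto simp: abs_le_iff)
    then have v1: "v < 1" using v by simp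
    have full: "\<bar>q i\<bar> = 1" if "q \<in> tree Y" "s * q n \<ge> v" "i < n" for q i
      using tree_coordinates(2)[OF Y that(1,3)] that(2) v(1) by fastforce
    define c where "c = (\<lambda>i. if i < n then x i else if i = n then s * v else 0)"
    define U where "U = {q. v < s * q n} \<inter> (\<Inter>i<n. {q. 0 < q i * x i})"
    define V where "V = {q. s * q n < v} \<union> (\<Union>i<n. {q. q i * x i < 0})"
    have "open U" unfolding U_def
      by (intro open_Int open_INT ballI open_Collect_less continuous_intros
          continuous_on_product_coordinates) auto
    moreover have "open V" unfolding V_def
      by (intro open_Un open_UN ballI open_Collect_less continuous_intros
          continuous_on_product_coordinates)
    moreover have "U \<inter> V = {}" by (force simp: U_def V_def)
    moreover have "x \<in> U"
    proof -
      have "0 < x i * x i" if "i < n" for i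
        using full[OF x less_imp_le[OF v(3)] that] by (auto simp: zero_less_mult_iff)
      then show ?thesis using v by (auto simp: U_def)
    qed
    moreover have "z \<in> V" using v by (auto simp: V_def)
    moreover have "x \<noteq> c" "z \<noteq> c" using v s by (auto simp: c_def fun_eq_iff)
    moreover have "q = c" if q: "q \<in> tree Y" "q \<notin> U" "q \<notin> V" for q
    proof
      have ge: "s * q n \<ge> v" and nn: "\<And>i. i < n \<Longrightarrow> q i * x i \<ge> 0"
        using q(3) by (auto simp: V_def not_less)
      have same: "q i = x i" if "i < n" for i
        using full[OF q(1) ge that] full[OF x less_imp_le[OF v(3)] that] nn[OF that]
        by (auto simp: abs_if zero_le_mult_iff split: if_splits)
      have "0 < q i * x i" if "i < n" for i
        using full[OF q(1) ge that] same[OF that] by (auto simp: zero_less_mult_iff)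
      then have "s * q n = v" using q(2) ge by (auto simp: U_def)
      then have qn: "q n = s * v" using s by auto
      have "q i = 0" if "n < i" for i
        by (rule ccontr) (use tree_coordinates(2)[OF Y q(1) that] qn v1 v(1) s in auto)
      then show "q i = c i" for i using same qn by (auto simp: c_def not_less_iff_gr_or_eq)
    qed
    ultimately show ?thesis by (intro exI[of _ c] exI[of _ U] exI[of _ V]) auto
  qed
  have "(0 < a n \<and> b n < a n) \<or> (0 < - a n \<and> - b n < - a n) \<or>
      (0 < b n \<and> a n < b n) \<or> (0 < - b n \<and> - a n < - b n)" using n by linarith
  then consider s where "s = 1 \<or> s = -1" "s * a n > 0" "s * a n > s * b n"
    | s where "s = 1 \<or> s = -1" "s * b n > 0" "s * b n > s * a n"
    by (metis mult_1 mult_minus1)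
  then show ?thesis
  proof cases
    case 1
    from sep[OF a, of s b] 1 show ?thesis using that by blast
  next
    case 2
    from sep[OF b, of s a] 2 obtain c U V where "open U" "open V" "U \<inter> V = {}"
      "tree Y - {c} \<subseteq> U \<union> V" "b \<in> U - {c}" "a \<in> V - {c}" by blast
    then show ?thesis using that[of V U c] by (simp add: Int_commute Un_commute)
  qed
qed

lemma connected_punctured_circle:
  assumes z: "norm z = 1"
  shows "connected (sphere (0::complex) 1 - {z})"
proof -
  have "sphere (0::complex) 1 - {z} = (\<lambda>t. z * exp (\<i> * of_real t)) ` {0<..<2*pi}"
  proof (intro equalityI subsetI)
    fix w assume w: "w \<in> sphere (0::complex) 1 - {z}"
    define t where "t = Arg2pi (w / z)"
    have "norm (w / z) = 1" using w z by (simp add: norm_divide)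
    then have wz: "w / z = exp (\<i> * of_real t)"
      using Arg2pi_eq[of "w / z"] unfolding t_def by simp
    then have "t \<noteq> 0" using w z by auto
    then have "t \<in> {0<..<2*pi}"
      using Arg2pi_ge_0[of "w / z"] Arg2pi_lt_2pi[of "w / z"] unfolding t_def by auto
    moreover have "w = z * exp (\<i> * of_real t)" using wz z by (cases "z = 0") (auto simp: field_simps)
    ultimately show "w \<in> (\<lambda>t. z * exp (\<i> * of_real t)) ` {0<..<2*pi}" by blast
  next
    fix w assume "w \<in> (\<lambda>t. z * exp (\<i> * of_real t)) ` {0<..<2*pi}"
    then obtain t where t: "0 < t" "t < 2*pi" "w = z * exp (\<i> * of_real t)" by auto
    have "exp (\<i> * of_real t) \<noteq> 1"
      using Arg2pi_unique[of 1 t 1] Arg2pi_unique[of 1 0 1] t by auto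
    then show "w \<in> sphere 0 1 - {z}" using t z by (auto simp: norm_mult)
  qed
  moreover have "connected ((\<lambda>t. z * exp (\<i> * of_real t)) ` {0<..<2*pi})"
    by (intro connected_continuous_image continuous_intros) simp
  ultimately show ?thesis by simp
qed

text \<open>
A circle stays connected when any one point is removed, but any two of its points would be
separated by some point of the tree.
\<close>

lemma no_circle_in_tree:
  assumes Y: "Y \<subseteq> sign_seqs" and C: "C \<subseteq> tree Y"
  shows "\<not> top_of_set C homeomorphic_space top_of_set (sphere (0::complex) 1)"
proof
  assume "top_of_set C homeomorphic_space top_of_set (sphere (0::complex) 1)"
  then obtain f g where fg: "homeomorphic_maps (top_of_set C) (top_of_set (sphere (0::complex) 1)) f g"
    unfolding homeomorphic_space_def by blast
  then have g: "continuous_on (sphere 0 1) g" "g ` sphere 0 1 \<subseteq> C"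
    and f: "f ` C \<subseteq> sphere 0 1" "\<And>x. x \<in> C \<Longrightarrow> g (f x) = x"
    and gf: "\<And>z. z \<in> sphere 0 1 \<Longrightarrow> f (g z) = z"
    unfolding homeomorphic_maps_def by auto
  have "C \<subseteq> g ` sphere 0 1" using f by force
  with g(2) have g': "g ` sphere 0 1 = C" by blast
  have inj: "inj_on g (sphere 0 1)" by (rule inj_on_inverseI[of _ f]) (rule gf)
  have one: "(1::complex) \<in> sphere 0 1" "(-1::complex) \<in> sphere 0 1" by auto
  have "g 1 \<noteq> g (-1)" using inj_onD[OF inj _ one] by auto
  have gC: "g 1 \<in> C" "g (-1) \<in> C" using g(2) one by blast+
  from tree_cut_point[OF Y subsetD[OF C gC(1)] subsetD[OF C gC(2)] \<open>g 1 \<noteq> g (-1)\<close>]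
  obtain c U V where c: "open U" "open V" "U \<inter> V = {}" "tree Y - {c} \<subseteq> U \<union> V"
    "g 1 \<in> U - {c}" "g (-1) \<in> V - {c}" .
  have "connected (C - {c})"
  proof (cases "c \<in> C")
    case True
    then obtain z where z: "z \<in> sphere 0 1" "c = g z" using g' by blast
    have "C - {c} = g ` (sphere 0 1 - {z})"
      using g' z inj_on_image_set_diff[OF inj, of "sphere 0 1" "{z}"] by auto
    moreover have "connected (g ` (sphere 0 1 - {z}))"
      using z g(1) by (intro connected_continuous_image connected_punctured_circle)
        (auto intro: continuous_on_subset)
    ultimately show ?thesis by simp
  next
    case False
    have "connected (g ` sphere 0 1)"
      using g(1) by (intro connected_continuous_image connected_sphere) auto
    then show ?thesis using False g' by simp
  qed
  moreover have "C - {c} \<subseteq> U \<union> V" using c(4) C by blast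
  moreover have "U \<inter> V \<inter> (C - {c}) = {}" using c(3) by blast
  moreover have "U \<inter> (C - {c}) \<noteq> {}" "V \<inter> (C - {c}) \<noteq> {}"
    using c(5,6) gC by auto
  ultimately show False using connectedD[of "C - {c}" U V] c(1,2) by blast
qed

lemma mtopology_dist_subset:
  "Metric_space.mtopology D dist = top_of_set (D :: 'a::metric_space set)"
proof -
  interpret Submetric UNIV "dist :: 'a \<Rightarrow> 'a \<Rightarrow> real" D
    by unfold_locales auto
  show ?thesis using mtopology_submetric by simp
qed

lemma Metric_space_dist_subset: "Metric_space (D :: 'a::metric_space set) dist"
  by unfold_locales (auto simp: dist_commute dist_triangle)

lemma dendrite_tree:
  assumes Y: "Y \<subseteq> sign_seqs" "compact Y" "Y \<noteq> {}"
  shows "dendrite (tree Y) dist"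
proof -
  have "profiles \<noteq> {}" using ramp_profile[of 0] by auto
  then have "tree Y \<noteq> {}" using Y(3) by (auto simp: tree_def)
  then have "continuum (tree Y) dist"
    unfolding continuum_def mtopology_dist_subset
    using connected_tree[OF Y(1)] compact_tree[OF Y(2)]
    by (metis Metric_space_dist_subset connectedin_def connectedin_iff_connected
        compact_space_subtopology compactin_euclidean_iff)
  then show ?thesis
    unfolding dendrite_def mtopology_dist_subset
    using locally_connected_tree[OF Y(1)] no_circle_in_tree[OF Y(1)]
    by (auto simp: subtopology_subtopology Int_absorb1)
qed

section \<open>The binary odometer\<close>

lemma mod_add_right_cancel:
  fixes a b n M :: nat
  assumes "(a + n) mod M = (b + n) mod M" "a < M" "b < M"
  shows "a = b"
proof -
  have "c = ((c + n) mod M + (M * n - n)) mod M" if "c < M" for c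
  proof -
    have "n \<le> M * n" using that by simp
    then have "c + n + (M * n - n) = c + M * n" by simp
    then have "((c + n) mod M + (M * n - n)) mod M = (c + M * n) mod M"
      by (simp only: mod_add_left_eq)
    then show ?thesis using that by simp
  qed
  then show ?thesis using assms by metis
qed

text \<open>
Adding one to the 2-adic integer with binary digits \<open>z\<close>: digit \<open>k\<close> flips if the carry passes all
lower digits.
\<close>

definition odometer :: "(nat \<Rightarrow> bool) \<Rightarrow> nat \<Rightarrow> bool" where
  "odometer z k \<longleftrightarrow> z k \<noteq> (\<forall>j<k. z j)"

text \<open>
The residue of the 2-adic integer \<open>z\<close> modulo \<open>2\<^sup>N\<close>.
\<close>

definition residue :: "nat \<Rightarrow> (nat \<Rightarrow> bool) \<Rightarrow> nat" where
  "residue N z = (\<Sum>j<N. of_bool (z j) * 2 ^ j)"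

lemma residue_0 [simp]: "residue 0 z = 0"
  by (simp add: residue_def)

lemma residue_Suc: "residue (Suc N) z = residue N z + of_bool (z N) * 2 ^ N"
  by (simp add: residue_def)

lemma residue_less: "residue N z < 2 ^ N"
  by (induction N) (auto simp: residue_Suc)

lemma residue_eq_iff: "residue N z = residue N w \<longleftrightarrow> (\<forall>j<N. z j = w j)"
proof (induction N)
  case (Suc N)
  have "residue (Suc N) z = residue (Suc N) w \<longleftrightarrow> residue N z = residue N w \<and> z N = w N"
    using residue_less[of N z] residue_less[of N w] by (auto simp: residue_Suc)
  then show ?case using Suc by (auto simp: less_Suc_eq)
qed simp

lemma residue_odometer:
  "residue N (odometer z) + of_bool (\<forall>j<N. z j) * 2 ^ N = residue N z + 1"
proof (induction N)
  case (Suc N)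
  then show ?case
    by (cases "z N"; cases "\<forall>j<N. z j") (auto simp: residue_Suc odometer_def less_Suc_eq)
qed simp

lemma residue_odometer_funpow:
  "residue N ((odometer ^^ n) z) = (residue N z + n) mod 2 ^ N"
proof (induction n)
  case (Suc n)
  have "residue N (odometer w) = (residue N w + 1) mod 2 ^ N" for w
  proof -
    have "residue N (odometer w) mod 2 ^ N = (residue N w + 1) mod 2 ^ N"
      by (subst residue_odometer[symmetric]) simp
    then show ?thesis by (simp add: residue_less)
  qed
  then show ?case by (simp add: Suc mod_simps)
qed (simp add: residue_less)

section \<open>The map on the dendrite\<close>

definition spin :: "bool \<Rightarrow> real" where
  "spin b = (if b then 1 else -1)"

definition weave :: "(nat \<Rightarrow> bool) \<Rightarrow> (nat \<Rightarrow> bool) \<Rightarrow> nat \<Rightarrow> real" where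
  "weave z c i = spin (if even i then z (i div 2) else c (i div 2))"

lemma spin_eq_iff [simp]: "spin a = spin b \<longleftrightarrow> a = b"
  by (simp add: spin_def)

lemma weave_even [simp]: "weave z c (2 * k) = spin (z k)"
  by (simp add: weave_def)

lemma weave_odd [simp]: "weave z c (Suc (2 * k)) = spin (c k)"
  by (simp add: weave_def)

lemma weave_eq_iff [simp]: "weave z c = weave z' c' \<longleftrightarrow> z = z' \<and> c = c'"
proof
  assume eq: "weave z c = weave z' c'"
  have "z k = z' k" "c k = c' k" for k
    using fun_cong[OF eq, of "2 * k"] fun_cong[OF eq, of "Suc (2 * k)"] by auto
  then show "z = z' \<and> c = c'" by blast
qed simp

lemma weave_agree:
  assumes "\<And>k. k < n \<Longrightarrow> z k = z' k" "\<And>k. k < n \<Longrightarrow> c k = c' k" "i < n"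
  shows "weave z c i = weave z' c' i"
proof -
  have "i div 2 < n" using assms(3) by linarith
  then show ?thesis using assms(1,2) by (simp add: weave_def)
qed

lemma weave_sign: "weave z c \<in> sign_seqs"
  by (simp add: sign_seqs_def weave_def spin_def)

lemma sign_seq_weave:
  assumes "y \<in> sign_seqs" obtains z c where "y = weave z c"
proof -
  have "y = weave (\<lambda>k. y (2 * k) = 1) (\<lambda>k. y (Suc (2 * k)) = 1)"
  proof
    fix i
    have "y i = 1 \<or> y i = -1" using assms by (simp add: sign_seqs_def)
    then show "y i = weave (\<lambda>k. y (2 * k) = 1) (\<lambda>k. y (Suc (2 * k)) = 1) i"
      by (cases "even i") (auto simp: weave_def spin_def)
  qed
  then show ?thesis by (rule that)
qed

lemma closed_sign_seqs: "closed sign_seqs"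
  unfolding sign_seqs_def
  by (intro closed_Collect_all closed_Collect_disj closed_Collect_eq
      continuous_on_const continuous_on_product_coordinates)

lemma sign_seqs_agree:
  assumes "p \<in> sign_seqs" "q \<in> sign_seqs" "q \<in> coord_box n e p" "e \<le> 1" "i < n"
  shows "q i = p i"
proof -
  have "\<bar>q i - p i\<bar> < 1" using assms(3-5) by (force simp: coord_box_def)
  moreover have "p i = 1 \<or> p i = -1" "q i = 1 \<or> q i = -1"
    using assms(1,2) by (auto simp: sign_seqs_def)
  ultimately show ?thesis by auto
qed

text \<open>
On ends, even coordinates carry the odometer and odd coordinates the shift. For \<open>p i = 1\<close> or
\<open>p i = -1\<close> the product is \<open>1\<close> if the carry reaches the digit and \<open>0\<close> otherwise. The factor
\<open>\<bar>p (i + 2)\<bar>\<close> lowers the height by two: even coordinates then lose height at the same rate as the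
odd ones, which the shift moves by two places.
\<close>

definition step :: "(nat \<Rightarrow> real) \<Rightarrow> nat \<Rightarrow> real" where
  "step p i = (if even i
     then \<bar>p (i + 2)\<bar> * (p i * (1 - 2 * (\<Prod>k<i div 2. (1 + p (2 * k)) / 2)))
     else p (i + 2))"

lemma continuous_step: "continuous_on A step"
proof (rule continuous_on_subset[OF _ subset_UNIV], rule continuous_on_coordinatewise_then_product)
  fix i :: nat
  have "continuous_on UNIV (\<lambda>p :: nat \<Rightarrow> real. \<bar>p (i + 2)\<bar> * (p i * (1 - 2 * (\<Prod>k<i div 2. (1 + p (2 * k)) / 2))))"
    by (intro continuous_on_mult continuous_on_rabs continuous_on_diff continuous_on_const
        continuous_on_prod continuous_on_divide continuous_on_add continuous_on_product_coordinates) auto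
  moreover have "continuous_on UNIV (\<lambda>p :: nat \<Rightarrow> real. p (i + 2))"
    by (rule continuous_on_product_coordinates)
  ultimately show "continuous_on UNIV (\<lambda>p. step p i)"
    by (cases "even i") (simp_all add: step_def)
qed

lemma step_weave: "step (weave z c) = weave (odometer z) (\<lambda>j. c (Suc j))"
proof
  fix i
  have prod: "(\<Prod>k<n. (1 + spin (z k)) / 2) = of_bool (\<forall>k<n. z k)" for n
    by (induction n) (auto simp: spin_def less_Suc_eq)
  show "step (weave z c) i = weave (odometer z) (\<lambda>j. c (Suc j)) i"
  proof (cases "even i")
    case True
    then obtain k where k: "i = 2 * k" by blast
    have "weave z c (2 * k + 2) = spin (z (Suc k))" using weave_even[of z c "Suc k"] by simp
    then show ?thesis using prod[of k]
      by (auto simp: k step_def spin_def odometer_def)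
  next
    case False
    then obtain k where k: "i = Suc (2 * k)" by (auto elim: oddE)
    have "weave z c (Suc (2 * k) + 2) = spin (c (Suc k))" using weave_odd[of z c "Suc k"] by simp
    then show ?thesis by (simp add: k step_def)
  qed
qed

lemma step_funpow_weave:
  "(step ^^ n) (weave z c) = weave ((odometer ^^ n) z) (\<lambda>j. c (n + j))"
  by (induction n) (simp_all add: step_weave)

text \<open>
Where \<open>h (i + 2)\<close> is nonzero, \<open>h\<close> is \<open>1\<close> at all coordinates up to \<open>i + 1\<close>, so that the digits which
the odometer reads there are intact.
\<close>

lemma step_scale:
  assumes h: "h \<in> profiles" and y: "y \<in> sign_seqs"
  shows "step (scale h y) = scale (\<lambda>i. h (i + 2)) (step y)"
proof
  fix i
  show "step (scale h y) i = scale (\<lambda>i. h (i + 2)) (step y) i"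
  proof (cases "h (i + 2) = 0 \<or> odd i")
    case True
    then show ?thesis by (auto simp: step_def scale_def)
  next
    case False
    then have full: "h j = 1" if "j < i + 2" for j
      using profile_full_below[OF h that] by simp
    have "(\<Prod>k<i div 2. (1 + scale h y (2 * k)) / 2) = (\<Prod>k<i div 2. (1 + y (2 * k)) / 2)"
      by (intro prod.cong refl) (auto simp: scale_def full)
    moreover have "\<bar>h (i + 2)\<bar> = h (i + 2)" using profilesD(1)[OF h] by simp
    moreover have "h i = 1" using full[of i] by simp
    ultimately show ?thesis using False by (simp add: step_def scale_def abs_mult)
  qed
qed

lemma step_sign_seqs: "y \<in> sign_seqs \<Longrightarrow> step y \<in> sign_seqs"
  by (metis sign_seq_weave step_weave weave_sign)

lemma profiles_shift: "h \<in> profiles \<Longrightarrow> (\<lambda>i. h (i + n)) \<in> profiles"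
  unfolding profiles_def mem_Collect_eq add_Suc by blast

lemma step_funpow_scale:
  assumes "h \<in> profiles" "y \<in> sign_seqs"
  shows "(step ^^ n) (scale h y) = scale (\<lambda>i. h (i + 2 * n)) ((step ^^ n) y)
    \<and> (step ^^ n) y \<in> sign_seqs"
proof (induction n)
  case (Suc n)
  then have "(step ^^ Suc n) (scale h y) = scale (\<lambda>i. h (i + 2 + 2 * n)) ((step ^^ Suc n) y)"
    using step_scale[OF profiles_shift[OF assms(1), of "2 * n"], of "(step ^^ n) y"] by simp
  moreover have "i + 2 + 2 * n = i + 2 * Suc n" for i by simp
  ultimately show ?case using Suc step_sign_seqs by simp
qed (simp add: assms(2))

lemma step_tree:
  assumes "Y \<subseteq> sign_seqs" "step ` Y \<subseteq> Y" "p \<in> tree Y"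
  shows "step p \<in> tree Y"
proof -
  from assms(3) obtain h y where h: "h \<in> profiles" "y \<in> Y" "p = scale h y"
    by (auto simp: tree_def)
  then have "step p = scale (\<lambda>i. h (i + 2)) (step y)" using step_scale assms(1) by blast
  moreover have "step y \<in> Y" using h assms(2) by blast
  ultimately show ?thesis
    using profiles_shift[OF h(1), of 2] unfolding tree_def
    by (intro image_eqI[of _ _ "(\<lambda>i. h (i + 2), step y)"]) auto
qed

lemma ends_in_tree: "Y \<subseteq> tree Y"
proof
  fix y assume "y \<in> Y"
  moreover have "ramp 1 \<in> profiles" by (rule ramp_profile) simp
  moreover have "y = scale (ramp 1) y" by (simp add: scale_def ramp_1)
  ultimately show "y \<in> tree Y"
    unfolding tree_def by (intro image_eqI[of _ _ "(ramp 1, y)"]) auto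
qed

text \<open>
A profile other than \<open>1\<close> has finite support, and each step shifts it by two.
\<close>

lemma non_end_falls_to_root:
  assumes Y: "Y \<subseteq> sign_seqs" and p: "p \<in> tree Y - Y"
  obtains N where "\<And>n. n \<ge> N \<Longrightarrow> (step ^^ n) p = (\<lambda>i. 0)"
proof -
  from p obtain h y where h: "h \<in> profiles" "y \<in> Y" "p = scale h y"
    by (auto simp: tree_def)
  have "\<exists>m. h m \<noteq> 1"
  proof (rule ccontr)
    assume "\<not> ?thesis"
    then have "p = y" by (simp add: h(3) scale_def)
    then show False using h(2) p by simp
  qed
  then obtain m where m: "h m \<noteq> 1" by blast
  have "h i = 0" if "m < i" for i using profile_full_below[OF h(1) that] m by blast
  then have "(step ^^ n) p = (\<lambda>i. 0)" if "n \<ge> Suc m" for n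
    using that step_funpow_scale[OF h(1), of y n] h(2,3) Y by (auto simp: scale_def)
  then show ?thesis by (rule that)
qed

section \<open>Marks that steer the odometer\<close>

text \<open>
The digits of the odometer when the \<open>i\<close>-th mark passes: those of \<open>s\<close> at even places, and at odd
places a finite word that is the first component of the pair coded by \<open>i\<close>. Every finite word thus
recurs for infinitely many \<open>i\<close>.
\<close>

definition target :: "(nat \<Rightarrow> bool) \<Rightarrow> nat \<Rightarrow> nat \<Rightarrow> bool" where
  "target s i j \<longleftrightarrow> (if even j then s (j div 2) else j div 2 \<in> set_decode (fst (prod_decode i)))"

text \<open>
The second summand is less than \<open>2\<^sup>i\<close>; it corrects the time \<open>4\<^sup>i\<close>, which is \<open>0\<close> modulo \<open>2\<^sup>i\<close>, so that
the odometer started at \<open>s\<close> shows the target. Adding \<open>2\<^sup>i\<close> keeps the subtraction of natural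
numbers from being truncated.
\<close>

definition mark_time :: "(nat \<Rightarrow> bool) \<Rightarrow> nat \<Rightarrow> nat" where
  "mark_time s i = 4 ^ i + (residue i (target s i) + 2 ^ i - residue i s) mod 2 ^ i"

definition marks :: "(nat \<Rightarrow> bool) \<Rightarrow> nat \<Rightarrow> bool" where
  "marks s n \<longleftrightarrow> (\<exists>i. n = mark_time s i)"

lemma two_power_le_four_power: "(2::nat) ^ i \<le> 4 ^ i"
  by (intro power_mono) auto

lemma mark_time_bounds: "4 ^ i \<le> mark_time s i" "mark_time s i < 2 * 4 ^ i"
proof -
  have "(residue i (target s i) + 2 ^ i - residue i s) mod 2 ^ i < 2 ^ i" by simp
  also have "\<dots> \<le> 4 ^ i" by (rule two_power_le_four_power)
  finally show "mark_time s i < 2 * 4 ^ i" by (simp add: mark_time_def)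
qed (simp add: mark_time_def)

lemma less_four_power: "i < (4::nat) ^ i"
  using less_le_trans[OF less_exp two_power_le_four_power] .

lemma mark_time_gap:
  assumes "i < j" shows "mark_time s i + 2 * 4 ^ i \<le> mark_time s j"
proof -
  have "(4::nat) ^ Suc i \<le> 4 ^ j" using assms by (intro power_increasing) auto
  then show ?thesis using mark_time_bounds(2)[of s i] mark_time_bounds(1)[of j s] by simp
qed

lemma mark_time_hits_target:
  assumes "j < i"
  shows "(odometer ^^ mark_time s i) s j = target s i j"
proof -
  let ?t = "residue i (target s i)" and ?r = "residue i s"
  have "?r + (4 ^ i + (?t + 2 ^ i - ?r)) = ?t + 2 ^ i * (2 ^ i + 1)"
    using residue_less[of i s] by (simp add: algebra_simps flip: power_mult_distrib)
  then have "(?r + mark_time s i) mod 2 ^ i = ?t mod 2 ^ i"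
    unfolding mark_time_def by (metis add.assoc mod_add_right_eq mod_mult_self2)
  then have "residue i ((odometer ^^ mark_time s i) s) = ?t"
    by (simp add: residue_odometer_funpow residue_less)
  then show ?thesis using assms by (simp add: residue_eq_iff)
qed

text \<open>
The \<open>i\<close>-th mark depends on the first \<open>i\<close> digits of \<open>s\<close> only and occurs after time \<open>i\<close>. So the marks are
a continuous function of \<open>s\<close>.
\<close>

lemma marks_local:
  assumes "\<And>j. j < n \<Longrightarrow> s j = t j"
  shows "marks s n = marks t n"
proof -
  have "mark_time s i = mark_time t i" if "i \<le> n" for i
  proof -
    have "residue i s = residue i t" "residue i (target s i) = residue i (target t i)"
      using assms that by (auto simp: residue_eq_iff target_def)
    then show ?thesis by (simp add: mark_time_def)
  qed
  moreover have "i \<le> n" if "n = mark_time s i \<or> n = mark_time t i" for i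
    using that mark_time_bounds(1)[of i s] mark_time_bounds(1)[of i t] less_four_power[of i] by linarith
  ultimately show ?thesis unfolding marks_def by metis
qed

text \<open>
The starting points of the odometer are constant on each of the infinite blocks
\<open>{j. fst (prod_decode j) = k}\<close>. A tail of such a sequence determines all of it. The block of \<open>0\<close> is
set to \<open>False\<close> in order to stop carries infinitely often.
\<close>

definition base_points :: "(nat \<Rightarrow> bool) set" where
  "base_points = {s. \<not> s 0 \<and> (\<forall>i j. fst (prod_decode i) = fst (prod_decode j) \<longrightarrow> s i = s j)}"

lemma base_pointsD:
  assumes "s \<in> base_points"
  shows "\<not> s 0" "fst (prod_decode i) = fst (prod_decode j) \<Longrightarrow> s i = s j"
  using assms unfolding base_points_def by blast+

lemma base_points_later_copy:
  obtains j where "N \<le> j" "\<And>s. s \<in> base_points \<Longrightarrow> s j = s i"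
proof
  let ?j = "prod_encode (fst (prod_decode i), N)"
  show "N \<le> ?j" by (rule le_prod_encode_2)
  show "s ?j = s i" if "s \<in> base_points" for s by (rule base_pointsD(2)[OF that]) simp
qed

lemma uncountable_bool_seqs: "uncountable (UNIV :: (nat \<Rightarrow> bool) set)"
proof
  assume "countable (UNIV :: (nat \<Rightarrow> bool) set)"
  then obtain f :: "nat \<Rightarrow> nat \<Rightarrow> bool" where "range f = UNIV"
    using uncountable_def by blast
  then obtain n where "f n = (\<lambda>k. \<not> f k k)" by (metis UNIV_I imageE)
  then show False by (metis (full_types))
qed

lemma uncountable_base_points: "uncountable base_points"
proof
  define g where "g = (\<lambda>(\<alpha> :: nat \<Rightarrow> bool) j.
    case fst (prod_decode j) of 0 \<Rightarrow> False | Suc k \<Rightarrow> \<alpha> k)"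
  assume "countable base_points"
  moreover have "range g \<subseteq> base_points"
  proof -
    have "fst (prod_decode 0) = 0" using prod_encode_inverse[of "(0, 0)"] by (simp add: prod_encode_def)
    then have "g \<alpha> \<in> base_points" for \<alpha> by (simp add: base_points_def g_def)
    then show ?thesis by blast
  qed
  ultimately have "countable (range g)" using countable_subset by blast
  moreover have "inj g"
  proof
    fix \<alpha> \<beta> assume eq: "g \<alpha> = g \<beta>"
    show "\<alpha> = \<beta>"
    proof
      fix k show "\<alpha> k = \<beta> k"
        using fun_cong[OF eq, of "prod_encode (Suc k, 0)"] by (simp add: g_def)
    qed
  qed
  ultimately show False using uncountable_bool_seqs countable_image_inj_on by blast
qed

text \<open>
The zeros in arbitrarily late positions of \<open>s\<close> absorb the carry when \<open>n\<close> is added. From there on, \<open>s\<close>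
and \<open>t\<close> have the same digits, and members of \<open>base_points\<close> with the same tail are equal.
\<close>

lemma base_points_orbits_disjoint:
  assumes s: "s \<in> base_points" and t: "t \<in> base_points" and eq: "(odometer ^^ n) s = t"
  shows "n = 0 \<and> s = t"
proof -
  have t_mod: "residue N t = (residue N s + n) mod 2 ^ N" for N
    using residue_odometer_funpow[of N n s] eq by simp
  have "\<exists>N\<ge>n. residue N s + n < 2 ^ N"
  proof -
    obtain j where j: "Suc n \<le> j" "\<And>s. s \<in> base_points \<Longrightarrow> s j = s 0"
      by (rule base_points_later_copy[of "Suc n" 0]) blast
    then have "\<not> s j" using s base_pointsD(1) by blast
    then have "residue (Suc j) s < 2 ^ j" by (simp add: residue_Suc residue_less)
    moreover have "n < 2 ^ j" using j(1) less_exp[of j] by linarith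
    ultimately have "residue (Suc j) s + n < 2 ^ Suc j" by simp
    then show ?thesis using j(1) by (intro exI[of _ "Suc j"]) auto
  qed
  then obtain N where N: "residue N s + n < 2 ^ N" by blast
  have no_carry: "residue M s + n < 2 ^ M" if "N \<le> M" for M
    using that
  proof (induction M rule: dec_induct)
    case (step M)
    then show ?case by (auto simp: residue_Suc)
  qed (rule N)
  have tail: "t M = s M" if "N \<le> M" for M
  proof -
    have "residue M t = residue M s + n" "residue (Suc M) t = residue (Suc M) s + n"
      using no_carry[of M] no_carry[of "Suc M"] that by (auto simp: t_mod)
    then show ?thesis by (cases "t M"; cases "s M") (simp_all add: residue_Suc)
  qed
  have "s = t"
  proof
    fix i
    obtain j where "N \<le> j" "\<And>s. s \<in> base_points \<Longrightarrow> s j = s i"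
      by (rule base_points_later_copy[of N i]) blast
    then show "s i = t i" using tail s t by metis
  qed
  moreover have "residue N t = residue N s + n" using no_carry[of N] by (simp add: t_mod)
  with \<open>s = t\<close> have "n = 0" by simp
  ultimately show ?thesis by blast
qed

section \<open>The compact set of ends\<close>

definition start :: "(nat \<Rightarrow> bool) \<Rightarrow> nat \<Rightarrow> real" where
  "start s = weave s (marks s)"

definition start_orbits :: "(nat \<Rightarrow> real) set" where
  "start_orbits = {(step ^^ n) (start s) |n s. s \<in> base_points}"

definition sparse_ends :: "(nat \<Rightarrow> real) set" where
  "sparse_ends = {weave z c |z c. \<forall>i j. c i \<longrightarrow> c j \<longrightarrow> i = j}"

definition ends :: "(nat \<Rightarrow> real) set" where
  "ends = start_orbits \<union> sparse_ends"

lemma step_funpow_start: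
  "(step ^^ n) (start s) = weave ((odometer ^^ n) s) (\<lambda>j. marks s (n + j))"
  by (simp add: start_def step_funpow_weave)

lemma ends_sign_seqs: "ends \<subseteq> sign_seqs"
  by (auto simp: ends_def start_orbits_def sparse_ends_def step_funpow_start weave_sign)

lemma step_ends: "step ` ends \<subseteq> ends"
proof -
  have "step y \<in> start_orbits" if "y \<in> start_orbits" for y
  proof -
    from that obtain n s where "s \<in> base_points" "y = (step ^^ n) (start s)" by (auto simp: start_orbits_def)
    then have "step y = (step ^^ Suc n) (start s)" by simp
    then show ?thesis unfolding start_orbits_def using \<open>s \<in> base_points\<close> by blast
  qed
  moreover have "step y \<in> sparse_ends" if "y \<in> sparse_ends" for y
    using that unfolding sparse_ends_def by (fastforce simp: step_weave)
  ultimately show ?thesis by (auto simp: ends_def)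
qed

text \<open>
Every digit and every mark of a limit is shared with start points that agree with the limit up to
there. The conditions on base points, and by \<open>marks_local\<close> the marks, are read off from finitely
many digits.
\<close>

lemma closed_starts: "closed (start ` base_points)"
proof -
  have "p \<in> start ` base_points" if p: "p \<in> closure (start ` base_points)" for p
  proof -
    have "start ` base_points \<subseteq> sign_seqs" by (auto simp: start_def weave_sign)
    then have sgn: "p \<in> sign_seqs" using p closed_sign_seqs closure_minimal by blast
    then obtain z c where zc: "p = weave z c" by (rule sign_seq_weave)
    have approx: "\<exists>s\<in>base_points. \<forall>k<n. s k = z k \<and> marks s k = c k" for n
    proof -
      have "\<exists>q\<in>start ` base_points. q \<in> coord_box (2 * n) 1 p"
        using p by (simp add: mem_closure_iff_box)
      then obtain s where s: "s \<in> base_points" "start s \<in> coord_box (2 * n) 1 p" by blast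
      have agree: "start s i = p i" if "i < 2 * n" for i
        using sign_seqs_agree[OF sgn _ s(2) _ that] by (simp add: start_def weave_sign)
      have "s k = z k \<and> marks s k = c k" if "k < n" for k
        using agree[of "2 * k"] agree[of "Suc (2 * k)"] that by (simp add: zc start_def)
      then show ?thesis using s(1) by blast
    qed
    have "z \<in> base_points"
    proof -
      have "\<not> z 0" using approx[of 1] base_pointsD(1) by auto
      moreover have "z i = z j" if "fst (prod_decode i) = fst (prod_decode j)" for i j
      proof -
        obtain s where s: "s \<in> base_points" "\<forall>k<Suc (max i j). s k = z k" using approx by blast
        have "z i = s i" "z j = s j" using s(2) by auto
        moreover have "s i = s j" using base_pointsD(2)[OF s(1) that] .
        ultimately show ?thesis by simp
      qed
      ultimately show ?thesis unfolding base_points_def by blast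
    qed
    moreover have "c = marks z"
    proof
      fix k
      obtain s where s: "\<forall>j<Suc k. s j = z j \<and> marks s j = c j" using approx by blast
      then have "marks s k = marks z k" by (intro marks_local) auto
      then show "c k = marks z k" using s by simp
    qed
    ultimately show ?thesis unfolding zc start_def by blast
  qed
  then have "closure (start ` base_points) \<subseteq> start ` base_points" by blast
  then show ?thesis by (metis closure_subset closure_closed closed_closure subset_antisym)
qed

lemma bounded_sign_seqs: "p \<in> sign_seqs \<Longrightarrow> \<bar>p i\<bar> \<le> 1"
  unfolding sign_seqs_def by (cases "p i = 1") auto

text \<open>
Let a limit of ends have two marks \<open>a < b\<close>. Ends close to it carry both marks too, so they lie on the
orbit of some start point, say \<open>n\<close> steps after the start. As the gap following a mark is at least as
long as the time of that mark, \<open>n \<le> b - a\<close>. Only finitely many compact sets of ends are left, the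
images of the set of start points under at most \<open>b\<close> steps, and the limit belongs to their union.
\<close>

lemma compact_ends: "compact ends"
proof (rule closed_in_cube_imp_compact)
  have "p \<in> ends" if p: "p \<in> closure ends" for p
  proof -
    have "p \<in> sign_seqs" using p ends_sign_seqs closed_sign_seqs closure_minimal by blast
    then obtain z c where zc: "p = weave z c" by (rule sign_seq_weave)
    show ?thesis
    proof (cases "\<forall>i j. c i \<longrightarrow> c j \<longrightarrow> i = j")
      case True
      then show ?thesis unfolding ends_def sparse_ends_def zc by blast
    next
      case False
      then obtain a b where ab: "c a" "c b" "a < b" by (metis linorder_neqE_nat)
      define K where "K = (\<Union>n\<le>b. (step ^^ n) ` (start ` base_points))"
      \<comment> \<open>the sequences that do not have both marks\<close>
      define G where "G = {q :: nat \<Rightarrow> real. q (Suc (2 * a)) \<le> 0 \<or> q (Suc (2 * b)) \<le> 0}"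
      have cont: "continuous_on A (step ^^ n)" for A n
      proof (induction n)
        case (Suc n)
        then show ?case using continuous_on_compose[OF Suc continuous_step] by simp
      qed (simp add: continuous_on_id)
      have "compact (start ` base_points)"
        by (rule closed_in_cube_imp_compact[OF closed_starts])
          (auto simp: start_def intro!: bounded_sign_seqs weave_sign)
      then have "compact K" unfolding K_def
        by (intro compact_UN finite_atMost ballI compact_continuous_image[OF cont])
      moreover have "closed G" unfolding G_def
        by (intro closed_Collect_disj closed_Collect_le continuous_on_const
            continuous_on_product_coordinates)
      ultimately have "closed (K \<union> G)" using compact_imp_closed by blast
      moreover have "ends \<subseteq> K \<union> G"
      proof
        fix y assume y: "y \<in> ends"
        show "y \<in> K \<union> G"
        proof (cases "y \<in> G")
          case False
          from y consider "y \<in> sparse_ends" | "y \<in> start_orbits" by (auto simp: ends_def)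
          then show ?thesis
          proof cases
            case 1
            then obtain z' c' where y': "y = weave z' c'" "\<forall>i j. c' i \<longrightarrow> c' j \<longrightarrow> i = j"
              by (auto simp: sparse_ends_def)
            then have "\<not> c' a \<or> \<not> c' b" using ab(3) by blast
            then show ?thesis by (auto simp: G_def spin_def y'(1))
          next
            case 2
            then obtain n s where ns: "s \<in> base_points" "y = (step ^^ n) (start s)"
              by (auto simp: start_orbits_def)
            with False have "marks s (n + a)" "marks s (n + b)"
              by (auto simp: G_def step_funpow_start spin_def split: if_splits)
            then obtain i j where ij: "n + a = mark_time s i" "n + b = mark_time s j"
              by (auto simp: marks_def)
            have "i < j"
            proof (rule ccontr)
              assume "\<not> i < j"
              then have "mark_time s j \<le> mark_time s i"
                using mark_time_gap[of j i s] by (cases "i = j") auto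
              then show False using ij ab(3) by linarith
            qed
            then have "n \<le> b"
              using mark_time_gap[of i j s] mark_time_bounds(2)[of s i] ij by linarith
            then show ?thesis using ns by (auto simp: K_def)
          qed
        qed simp
      qed
      ultimately have "p \<in> K \<union> G" using p closure_minimal by blast
      moreover have "p \<notin> G" using ab by (simp add: G_def zc spin_def)
      ultimately show ?thesis by (auto simp: K_def ends_def start_orbits_def)
    qed
  qed
  then have "closure ends \<subseteq> ends" by blast
  then show "closed ends" by (metis closure_subset closed_closure subset_antisym)
qed (rule bounded_sign_seqs, use ends_sign_seqs in blast)

section \<open>Scrambled sets are finite\<close>

text \<open>
If \<open>z\<close> and \<open>z'\<close> differ in digit \<open>k\<close>, adding the same number to both keeps them apart modulo
\<open>2\<^sup>k\<^sup>+\<^sup>1\<close>, so at every time the two points have opposite signs in one of the coordinates \<open>0, 2, \<dots>, 2 * k\<close>.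
\<close>

lemma proximal_same_odometer_state:
  assumes "proximal dist step (weave z c) (weave z' c')"
  shows "z = z'"
proof (rule ccontr)
  assume "z \<noteq> z'"
  then obtain k where k: "z k \<noteq> z' k" by blast
  define e where "e = Min ((\<lambda>j. (1/2::real) ^ to_nat (2 * j)) ` {..k})"
  have "0 < e" by (simp add: e_def)
  have "e \<le> dist ((step ^^ n) (weave z c)) ((step ^^ n) (weave z' c'))" for n
  proof -
    have "residue (Suc k) z \<noteq> residue (Suc k) z'" using k by (auto simp: residue_eq_iff)
    then have "residue (Suc k) ((odometer ^^ n) z) \<noteq> residue (Suc k) ((odometer ^^ n) z')"
      using mod_add_right_cancel[OF _ residue_less residue_less]
      unfolding residue_odometer_funpow by blast
    then obtain j where j: "j \<le> k" "(odometer ^^ n) z j \<noteq> (odometer ^^ n) z' j"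
      by (auto simp: residue_eq_iff less_Suc_eq_le)
    have "e \<le> (1/2) ^ to_nat (2 * j)" using j(1) by (auto simp: e_def intro!: Min_le)
    also have "\<dots> \<le> dist ((step ^^ n) (weave z c)) ((step ^^ n) (weave z' c'))"
      using coordinate_le_dist[of "2 * j" "(step ^^ n) (weave z c)" "(step ^^ n) (weave z' c')"] j(2)
      by (auto simp: step_funpow_weave spin_def split: if_splits)
    finally show ?thesis .
  qed
  then have "ereal e \<le> liminf (\<lambda>n. ereal (dist ((step ^^ n) (weave z c)) ((step ^^ n) (weave z' c'))))"
    by (intro Liminf_bounded always_eventually allI) simp
  then show False using assms \<open>0 < e\<close> by (simp add: proximal_def)
qed

lemma eventually_equal_not_scrambled:
  assumes "\<And>n. n \<ge> N \<Longrightarrow> (f ^^ n) x = (f ^^ n) y"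
  shows "\<not> scrambled_pair (dist :: 'a::metric_space \<Rightarrow> _) f x y"
proof -
  have "(\<lambda>n. dist ((f ^^ n) x) ((f ^^ n) y)) \<longlonglongrightarrow> 0"
    by (rule tendsto_eventually) (use assms in \<open>auto simp: eventually_sequentially\<close>)
  then show ?thesis by (auto simp: scrambled_pair_def asymptotic_def proximal_def)
qed

text \<open>
Over the same odometer state, the two orbits coincide as soon as the last mark has been shifted out.
\<close>

lemma sparse_ends_not_scrambled:
  assumes "x \<in> sparse_ends" "y \<in> sparse_ends"
  shows "\<not> scrambled_pair dist step x y"
proof
  assume sc: "scrambled_pair dist step x y"
  obtain z c where x: "x = weave z c" "\<And>i j. c i \<Longrightarrow> c j \<Longrightarrow> i = j"
    using assms(1) by (auto simp: sparse_ends_def)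
  obtain z' c' where y: "y = weave z' c'" "\<And>i j. c' i \<Longrightarrow> c' j \<Longrightarrow> i = j"
    using assms(2) by (auto simp: sparse_ends_def)
  have "z = z'" using sc proximal_same_odometer_state unfolding scrambled_pair_def x(1) y(1) by blast
  have "\<exists>M. \<forall>n\<ge>M. \<not> c n" using x(2) by (metis Suc_n_not_le_n)
  moreover have "\<exists>M. \<forall>n\<ge>M. \<not> c' n" using y(2) by (metis Suc_n_not_le_n)
  ultimately obtain M where M: "\<And>n. n \<ge> M \<Longrightarrow> \<not> c n \<and> \<not> c' n"
    by (metis max.boundedE)
  then have "(step ^^ n) x = (step ^^ n) y" if "n \<ge> M" for n
    using that by (simp add: x(1) y(1) \<open>z = z'\<close> step_funpow_weave)
  then show False using sc eventually_equal_not_scrambled by blast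
qed

text \<open>
A base point and the time elapsed can be recovered from the odometer state alone.
\<close>

lemma start_orbits_not_scrambled:
  assumes "x \<in> start_orbits" "y \<in> start_orbits"
  shows "\<not> scrambled_pair dist step x y"
proof
  assume sc: "scrambled_pair dist step x y"
  obtain n s where x: "s \<in> base_points" "x = (step ^^ n) (start s)"
    using assms(1) by (auto simp: start_orbits_def)
  obtain m t where y: "t \<in> base_points" "y = (step ^^ m) (start t)"
    using assms(2) by (auto simp: start_orbits_def)
  have eq: "(odometer ^^ n) s = (odometer ^^ m) t"
    using sc proximal_same_odometer_state unfolding scrambled_pair_def x(2) y(2) step_funpow_start by blast
  have inj: "inj odometer"
  proof
    fix a b assume ab: "odometer a = odometer b"
    show "a = b"
    proof
      fix k show "a k = b k"
      proof (induction k rule: less_induct)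
        case (less k)
        then show ?case using fun_cong[OF ab, of k] by (auto simp: odometer_def)
      qed
    qed
  qed
  have shift: "u = v \<and> i = j" if "u \<in> base_points" "v \<in> base_points" "i \<le> j"
    "(odometer ^^ i) u = (odometer ^^ j) v" for u v i j
  proof -
    have "(odometer ^^ i) u = (odometer ^^ i) ((odometer ^^ (j - i)) v)"
      using that(3,4) by (metis comp_apply funpow_add le_add_diff_inverse)
    then have "u = (odometer ^^ (j - i)) v" using inj by (metis inj_fn injD)
    then show ?thesis using base_points_orbits_disjoint[OF that(2,1), of "j - i"] that(3) by auto
  qed
  have "s = t \<and> n = m"
    using shift[OF x(1) y(1) _ eq] shift[OF y(1) x(1) _ eq[symmetric]] by (cases "n \<le> m") auto
  then have "x = y" using x y by simp
  then show False using sc by (simp add: scrambled_pair_def proximal_def)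
qed

lemma non_ends_not_scrambled:
  assumes "Y \<subseteq> sign_seqs" "x \<in> tree Y - Y" "y \<in> tree Y - Y"
  shows "\<not> scrambled_pair dist step x y"
proof -
  obtain N where N: "\<And>n. n \<ge> N \<Longrightarrow> (step ^^ n) x = (\<lambda>i. 0)"
    by (rule non_end_falls_to_root[OF assms(1,2)]) blast
  obtain M where M: "\<And>n. n \<ge> M \<Longrightarrow> (step ^^ n) y = (\<lambda>i. 0)"
    by (rule non_end_falls_to_root[OF assms(1,3)]) blast
  show ?thesis
    by (rule eventually_equal_not_scrambled[of "max N M"]) (simp add: N M)
qed

lemma LY_scrambled_finite:
  assumes "LY_scrambled (tree ends) dist step S"
  shows "finite S"
proof -
  have S: "S \<subseteq> tree ends" "\<And>x y. x \<in> S \<Longrightarrow> y \<in> S \<Longrightarrow> x \<noteq> y \<Longrightarrow> scrambled_pair dist step x y"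
    using assms by (auto simp: LY_scrambled_def)
  have fin: "finite (S \<inter> A)"
    if "\<And>x y. x \<in> A \<Longrightarrow> y \<in> A \<Longrightarrow> \<not> scrambled_pair dist step x y" for A
  proof -
    have "x = y" if "x \<in> S \<inter> A" "y \<in> S \<inter> A" for x y
      using S(2)[of x y] that \<open>x \<in> S \<inter> A\<close> \<open>\<And>x y. x \<in> A \<Longrightarrow> y \<in> A \<Longrightarrow> \<not> scrambled_pair dist step x y\<close> by blast
    then have "S \<inter> A = {} \<or> (\<exists>x. S \<inter> A = {x})" by blast
    then show ?thesis by auto
  qed
  have "finite (S \<inter> (tree ends - ends))"
    by (rule fin) (use non_ends_not_scrambled[OF ends_sign_seqs] in blast)
  moreover have "finite (S \<inter> start_orbits)" "finite (S \<inter> sparse_ends)"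
    using fin start_orbits_not_scrambled sparse_ends_not_scrambled by blast+
  moreover have "S \<subseteq> S \<inter> (tree ends - ends) \<union> S \<inter> start_orbits \<union> S \<inter> sparse_ends"
    using S(1) by (auto simp: ends_def)
  ultimately show ?thesis by (meson finite_UnI finite_subset)
qed

section \<open>Limit sets\<close>

lemma funpow_start_end:
  "s \<in> base_points \<Longrightarrow> (step ^^ n) (start s) \<in> ends"
  by (auto simp: ends_def start_orbits_def)

text \<open>
Ends have entries \<open>1\<close> and \<open>-1\<close> only, so being close to an end means agreeing with it on an initial
segment.
\<close>

lemma omega_limit_start_iff:
  assumes s: "s \<in> base_points" and w: "w \<in> ends"
  shows "w \<in> omega_limit (tree ends) dist step (start s) \<longleftrightarrow>
    (\<forall>N. \<exists>m\<ge>N. \<forall>i<N. (step ^^ m) (start s) i = w i)"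
proof -
  let ?x = "start s"
  have orb: "orbit_of step ((step ^^ n) ?x) = {(step ^^ m) ?x |m. m \<ge> n}" for n
  proof -
    have "(step ^^ k) ((step ^^ n) ?x) = (step ^^ (n + k)) ?x" for k
      by (metis add.commute comp_apply funpow_add)
    then show ?thesis unfolding orbit_of_def by (auto simp: le_iff_add)
  qed
  have "orbit_of step ((step ^^ n) ?x) \<subseteq> tree ends" for n
    using funpow_start_end[OF s] ends_in_tree[of ends] by (auto simp: orb)
  then have "omega_limit (tree ends) dist step ?x =
      (\<Inter>n. tree ends \<inter> closure {(step ^^ m) ?x |m. m \<ge> n})"
    unfolding omega_limit_def mtopology_dist_subset
    by (simp add: closure_of_subtopology orb Int_absorb1)
  then have "w \<in> omega_limit (tree ends) dist step ?x \<longleftrightarrow>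
      (\<forall>n k. \<forall>e>0. \<exists>m\<ge>n. (step ^^ m) ?x \<in> coord_box k e w)"
  proof -
    have "(\<exists>q\<in>{(step ^^ m) ?x |m. m \<ge> n}. q \<in> B) \<longleftrightarrow> (\<exists>m\<ge>n. (step ^^ m) ?x \<in> B)" for n B
      by blast
    moreover have "w \<in> tree ends" using w ends_in_tree by blast
    ultimately show ?thesis using \<open>omega_limit (tree ends) dist step ?x = _\<close>
      by (simp only: mem_closure_iff_box INT_iff Int_iff ball_UNIV simp_thms)
  qed
  also have "\<dots> \<longleftrightarrow> (\<forall>N. \<exists>m\<ge>N. \<forall>i<N. (step ^^ m) ?x i = w i)"
  proof
    assume l: "\<forall>n k. \<forall>e>0. \<exists>m\<ge>n. (step ^^ m) ?x \<in> coord_box k e w"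
    show "\<forall>N. \<exists>m\<ge>N. \<forall>i<N. (step ^^ m) ?x i = w i"
    proof
      fix N
      obtain m where m: "m \<ge> N" "(step ^^ m) ?x \<in> coord_box N 1 w" using l zero_less_one by blast
      have "(step ^^ m) ?x \<in> sign_seqs" "w \<in> sign_seqs"
        using funpow_start_end[OF s] w ends_sign_seqs by blast+
      then have "\<forall>i<N. (step ^^ m) ?x i = w i" using sign_seqs_agree m(2) by blast
      then show "\<exists>m\<ge>N. \<forall>i<N. (step ^^ m) ?x i = w i" using m(1) by blast
    qed
  next
    assume r: "\<forall>N. \<exists>m\<ge>N. \<forall>i<N. (step ^^ m) ?x i = w i"
    show "\<forall>n k. \<forall>e>0. \<exists>m\<ge>n. (step ^^ m) ?x \<in> coord_box k e w"
    proof (intro allI impI)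
      fix n k and e :: real assume "e > 0"
      obtain m where "m \<ge> max n k" "\<forall>i<max n k. (step ^^ m) ?x i = w i" using r by blast
      then show "\<exists>m\<ge>n. (step ^^ m) ?x \<in> coord_box k e w"
        using \<open>e > 0\<close> by (intro exI[of _ m]) (auto simp: coord_box_def)
    qed
  qed
  finally show ?thesis .
qed

definition single_mark :: "(nat \<Rightarrow> bool) \<Rightarrow> nat \<Rightarrow> real" where
  "single_mark z = weave z (\<lambda>j. j = 0)"

lemma single_mark_end: "single_mark z \<in> ends"
  unfolding single_mark_def ends_def sparse_ends_def by blast

text \<open>
A single mark at coordinate zero can only be approximated at the times of marks, and at the time
of the \<open>i\<close>-th mark the first \<open>i\<close> digits are those of the target. Conversely, given \<open>N\<close> digits of \<open>z\<close>,
the odd ones form a word that is the target of some mark \<open>i \<ge> N\<close>, after which no mark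
follows within time \<open>N\<close>.
\<close>

lemma single_mark_in_omega_limit_iff:
  assumes s: "s \<in> base_points"
  shows "single_mark z \<in> omega_limit (tree ends) dist step (start s) \<longleftrightarrow> (\<forall>j. z (2 * j) = s j)"
  unfolding omega_limit_start_iff[OF s single_mark_end]
  unfolding step_funpow_start single_mark_def
proof
  assume r: "\<forall>j. z (2 * j) = s j"
  show "\<forall>N. \<exists>m\<ge>N. \<forall>i<N. weave ((odometer ^^ m) s) (\<lambda>j. marks s (m + j)) i = weave z (\<lambda>j. j = 0) i"
  proof
    fix N
    define A where "A = {j. j < N \<and> z (Suc (2 * j))}"
    define i where "i = prod_encode (set_encode A, N)"
    have "finite A" by (simp add: A_def)
    have "N \<le> i" by (simp add: i_def le_prod_encode_2)
    define m where "m = mark_time s i"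
    have "(odometer ^^ m) s k = z k" if "k < N" for k
    proof -
      have "(odometer ^^ m) s k = target s i k"
        unfolding m_def using that \<open>N \<le> i\<close> by (intro mark_time_hits_target) simp
      also have "\<dots> = z k"
      proof (cases "even k")
        case True
        then obtain j where "k = 2 * j" by blast
        then show ?thesis using r by (simp add: target_def)
      next
        case False
        then obtain j where "k = Suc (2 * j)" by (auto elim: oddE)
        then show ?thesis using that \<open>finite A\<close> by (auto simp: target_def i_def A_def)
      qed
      finally show ?thesis .
    qed
    moreover have "marks s (m + k) = (k = 0)" if "k < N" for k
    proof
      assume "marks s (m + k)"
      then obtain j where j: "m + k = mark_time s j" by (auto simp: marks_def)
      show "k = 0"
      proof (rule ccontr)
        assume "k \<noteq> 0"
        have "i < j"
        proof (rule ccontr)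
          assume "\<not> i < j"
          then have "mark_time s j \<le> m"
            using mark_time_gap[of j i s] unfolding m_def by (cases "i = j") auto
          then show False using j \<open>k \<noteq> 0\<close> by linarith
        qed
        then have "2 * 4 ^ i \<le> k" using mark_time_gap[of i j s] j unfolding m_def by linarith
        then show False using less_four_power[of i] that \<open>N \<le> i\<close> by linarith
      qed
    qed (auto simp: m_def marks_def)
    moreover have "N \<le> m"
      using mark_time_bounds(1)[of i s] less_four_power[of i] \<open>N \<le> i\<close> unfolding m_def by linarith
    ultimately show "\<exists>m\<ge>N. \<forall>i<N. weave ((odometer ^^ m) s) (\<lambda>j. marks s (m + j)) i = weave z (\<lambda>j. j = 0) i"
      by (intro exI[of _ m] conjI allI impI weave_agree[where n = N]) simp_all
  qed
next
  assume l: "\<forall>N. \<exists>m\<ge>N. \<forall>i<N. weave ((odometer ^^ m) s) (\<lambda>j. marks s (m + j)) i = weave z (\<lambda>j. j = 0) i"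
  show "\<forall>j. z (2 * j) = s j"
  proof
    fix j
    \<comment> \<open>long enough to see digit \<open>2 * j\<close>, and such that the mark at time \<open>m \<ge> N\<close> has a number above \<open>2 * j\<close>\<close>
    define N where "N = 2 * 4 ^ (2 * j) + (2 * (2 * j) + 2 :: nat)"
    obtain m where m: "m \<ge> N" "\<forall>i<N. weave ((odometer ^^ m) s) (\<lambda>j. marks s (m + j)) i = weave z (\<lambda>j. j = 0) i"
      using l by blast
    have "Suc (2 * 0) < N" "2 * (2 * j) < N" by (simp_all add: N_def)
    with m(2) have *: "weave ((odometer ^^ m) s) (\<lambda>j. marks s (m + j)) (Suc (2 * 0)) = weave z (\<lambda>j. j = 0) (Suc (2 * 0))"
      "weave ((odometer ^^ m) s) (\<lambda>j. marks s (m + j)) (2 * (2 * j)) = weave z (\<lambda>j. j = 0) (2 * (2 * j))"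
      by blast+
    have "marks s m" using *(1) unfolding weave_odd by simp
    then obtain i where i: "m = mark_time s i" by (auto simp: marks_def)
    have "2 * j < i"
    proof (rule ccontr)
      assume "\<not> 2 * j < i"
      then have "(4::nat) ^ i \<le> 4 ^ (2 * j)" by (intro power_increasing) auto
      then show False using mark_time_bounds(2)[of s i] m(1) i unfolding N_def by linarith
    qed
    then have "(odometer ^^ m) s (2 * j) = target s i (2 * j)"
      unfolding i by (rule mark_time_hits_target)
    then show "z (2 * j) = s j" using *(2) unfolding weave_even by (simp add: target_def)
  qed
qed

text \<open>
Between the marks with numbers \<open>N\<close> and \<open>N + 1\<close> there is a stretch without marks that is longer than
\<open>2\<^sup>N + N\<close>. The odometer passes through all residues modulo \<open>2\<^sup>N\<close> in it, in particular
through \<open>0\<close> at the time \<open>m\<close> below.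
\<close>

lemma common_omega_limit_point:
  assumes s: "s \<in> base_points"
  shows "weave (\<lambda>_. False) (\<lambda>_. False) \<in> omega_limit (tree ends) dist step (start s)"
proof -
  have "weave (\<lambda>_. False) (\<lambda>_. False) \<in> ends" unfolding ends_def sparse_ends_def by blast
  note iff = omega_limit_start_iff[OF s this]
  show ?thesis unfolding iff step_funpow_start
  proof
    fix N
    \<comment> \<open>the 2-adic integer \<open>s + m\<close> is \<open>0\<close> modulo \<open>2\<^sup>N\<close>\<close>
    define m where "m = 2 * 4 ^ N + (2 ^ N - residue N s)"
    have "residue N ((odometer ^^ m) s) = residue N (\<lambda>_. False)"
    proof -
      have "residue N s + m = 2 ^ N * (2 * 2 ^ N + 1)"
        using residue_less[of N s] by (simp add: m_def algebra_simps flip: power_mult_distrib)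
      then show ?thesis by (simp add: residue_odometer_funpow) (simp add: residue_def)
    qed
    then have "(odometer ^^ m) s k = False" if "k < N" for k
      using that by (simp add: residue_eq_iff)
    moreover have "marks s (m + k) = False" if "k < N" for k
    proof -
      have "m + k \<noteq> mark_time s i" for i
      proof (cases "i \<le> N")
        case True
        then have "(4::nat) ^ i \<le> 4 ^ N" by (intro power_increasing) auto
        then show ?thesis using mark_time_bounds(2)[of s i] unfolding m_def by linarith
      next
        case False
        then have "(4::nat) ^ Suc N \<le> 4 ^ i" by (intro power_increasing) auto
        then show ?thesis using mark_time_bounds(1)[of i s] that less_four_power[of N]
            two_power_le_four_power[of N] less_exp[of N] unfolding m_def power_Suc by linarith
      qed
      then show ?thesis by (simp add: marks_def)
    qed
    moreover have "N \<le> m" using less_four_power[of N] unfolding m_def by linarith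
    ultimately show "\<exists>m\<ge>N. \<forall>i<N. weave ((odometer ^^ m) s) (\<lambda>j. marks s (m + j)) i
        = weave (\<lambda>_. False) (\<lambda>_. False) i"
      by (intro exI[of _ m] conjI allI impI weave_agree[where n = N]) simp_all
  qed
qed

lemma single_mark_not_periodic: "single_mark z \<notin> periodic_points X step"
proof
  assume "single_mark z \<in> periodic_points X step"
  then obtain p where "p > 0" "(step ^^ p) (single_mark z) = single_mark z" by (auto simp: periodic_points_def)
  then have "(\<lambda>j. p + j = 0) = (\<lambda>j. j = 0)" by (simp add: single_mark_def step_funpow_weave)
  from fun_cong[OF this, of 0] show False using \<open>p > 0\<close> by simp
qed

lemma omega_scrambled_starts: "omega_scrambled (tree ends) dist step (start ` base_points)"
proof -
  have start_eq: "start s = start t \<longleftrightarrow> s = t" for s t by (auto simp: start_def)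
  \<comment> \<open>\<open>sheet s u\<close> runs through all 2-adic integers with even digits \<open>s\<close> as \<open>u\<close> varies\<close>
  define sheet where "sheet = (\<lambda>(s :: nat \<Rightarrow> bool) (u :: nat \<Rightarrow> bool) k.
    if even k then s (k div 2) else u (k div 2))"
  have sheet: "sheet s u (2 * j) = s j" "sheet s u (Suc (2 * j)) = u j" for s u j
    by (simp_all add: sheet_def)
  have "start ` base_points \<subseteq> tree ends"
    using funpow_start_end[of _ 0] ends_in_tree by auto
  moreover have "\<exists>x\<in>start ` base_points. \<exists>y\<in>start ` base_points. x \<noteq> y"
  proof (rule ccontr)
    assume "\<not> ?thesis"
    then have "s = t" if "s \<in> base_points" "t \<in> base_points" for s t using that start_eq by blast
    then have "base_points = {} \<or> (\<exists>s. base_points = {s})" by blast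
    then have "finite base_points" by (metis finite.emptyI finite.insertI)
    then show False using uncountable_base_points countable_finite by blast
  qed
  moreover have "uncountable (omega_limit (tree ends) dist step (start s) - omega_limit (tree ends) dist step (start t))"
    if st: "s \<in> base_points" "t \<in> base_points" "s \<noteq> t" for s t
  proof
    assume "countable (omega_limit (tree ends) dist step (start s) - omega_limit (tree ends) dist step (start t))"
    moreover have "range (\<lambda>u. single_mark (sheet s u)) \<subseteq>
        omega_limit (tree ends) dist step (start s) - omega_limit (tree ends) dist step (start t)"
      using st by (auto simp: single_mark_in_omega_limit_iff sheet)
    ultimately have "countable (range (\<lambda>u. single_mark (sheet s u)))" using countable_subset by blast
    moreover have "inj (\<lambda>u. single_mark (sheet s u))"
    proof
      fix u v assume "single_mark (sheet s u) = single_mark (sheet s v)"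
      then have "sheet s u = sheet s v" by (simp add: single_mark_def)
      then have "sheet s u (Suc (2 * k)) = sheet s v (Suc (2 * k))" for k by simp
      then show "u = v" unfolding sheet by (rule ext)
    qed
    ultimately show False using uncountable_bool_seqs countable_image_inj_on by blast
  qed
  moreover have "omega_limit (tree ends) dist step (start s) \<inter> omega_limit (tree ends) dist step (start t) \<noteq> {}"
    if "s \<in> base_points" "t \<in> base_points" for s t
    using that common_omega_limit_point by blast
  moreover have "\<not> omega_limit (tree ends) dist step (start s) \<subseteq> periodic_points (tree ends) step"
    if "s \<in> base_points" for s
  proof -
    have "single_mark (sheet s s) \<in> omega_limit (tree ends) dist step (start s)"
      using that by (simp add: single_mark_in_omega_limit_iff sheet)
    then show ?thesis using single_mark_not_periodic by blast
  qed
  ultimately show ?thesis unfolding omega_scrambled_def by (auto simp: start_eq)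
qed

theorem theorem1p1:
  shows "\<exists>(D :: (nat \<Rightarrow> real) set) (\<rho> :: (nat \<Rightarrow> real) \<Rightarrow> (nat \<Rightarrow> real) \<Rightarrow> real)
            (f :: (nat \<Rightarrow> real) \<Rightarrow> (nat \<Rightarrow> real)).
           dendrite D \<rho> \<and>
           continuous_map (Metric_space.mtopology D \<rho>) (Metric_space.mtopology D \<rho>) f \<and>
           (\<exists>S. uncountable S \<and> omega_scrambled D \<rho> f S) \<and>
           \<not> (\<exists>S. infinite S \<and> LY_scrambled D \<rho> f S)"
proof (intro exI conjI)
  have "ends \<noteq> {}" using single_mark_end by blast
  then show "dendrite (tree ends) dist"
    using dendrite_tree[OF ends_sign_seqs compact_ends] by blast
  show "continuous_map (Metric_space.mtopology (tree ends) dist)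
      (Metric_space.mtopology (tree ends) dist) step"
    unfolding mtopology_dist_subset
    using continuous_step step_tree[OF ends_sign_seqs step_ends] by (simp add: image_subset_iff)
  show "uncountable (start ` base_points)"
    using uncountable_base_points countable_image_inj_on[of start base_points]
    by (auto simp: start_def inj_on_def)
  show "omega_scrambled (tree ends) dist step (start ` base_points)"
    by (rule omega_scrambled_starts)
  show "\<not> (\<exists>S. infinite S \<and> LY_scrambled (tree ends) dist step S)"
    using LY_scrambled_finite by blast
qed

end
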